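(* There exists $c>0$ such that for every $t\in[c\log n,\,n/\log n]$, $$\mathsf{size\text{-}pls}(\mathrm{DIAM},t)=O\left(\frac{n}{t}\log^2 n\right).$$ Moreover, for every $t\in[1,\,n/\log n]$, $$\mathsf{size\text{-}pls}(\mathrm{DIAM},t)=\Omega\left(\frac{n}{t\log n}\right).$$ Here $n$ is the number of nodes, and the hidden constants do not depend on $n$ or $t$.
   Context: Predicate. For a labeled (weighted) graph $(G,x)$, the predicate $\mathrm{DIAM}$ holds on $(G,x)$ iff, for every node $v\in V(G)$, $x(v)$ is equal to the (weighted) diameter of $G$. Weighted $n$-node graphs have edge weights $w:E\to[1,n^{c'}]$ for a fixed $c'\ge1$, encodable on $O(\log n)$ bits. Model. A labeled graph is a pair $(G,x)$ where $G=(V,E)$ is a finite connected simple graph and $x:V\to\{0,1\}^*$ assigns a bit-string (label) to every node. An identity assignment is an injective map $\mathrm{ID}:V\to[1,n^{c'}]$ for some fixed $c'\ge 1$, where $n=|V|$. A proof-labeling scheme (PLS) for a predicate $\mathcal{P}$ is a pair $(\mathbf{p},\mathbf{v})$, where the prover $\mathbf{p}$ assigns to every node $v$ of every instance $(G,x,\mathrm{ID})$ a bit-string called certificate, and the verifier $\mathbf{v}$ is a deterministic distributed algorithm in the LOCAL model in which every node outputs accept or reject, such that: (i) if $(G,x,\mathrm{ID})$ satisfies $\mathcal{P}$, then all nodes accept with the certificates given by $\mathbf{p}$; (ii) if $(G,x,\mathrm{ID})$ does not satisfy $\mathcal{P}$, then for every assignment of certificates to the nodes, at least one node rejects. The radius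 of the scheme is the maximum number of rounds of $\mathbf{v}$; a scheme of radius $t$ is one where, equivalently, each node $v$ decides from $t$, the structure of the ball of radius $t$ (in hops) around $v$, and the identities, labels, incident edge weights and certificates of the nodes at distance at most $t$ from $v$ (arbitrary local computation is allowed). The size of a scheme, as a function of $n$, is the maximum number of bits of a certificate assigned by $\mathbf{p}$ to a node, over all $n$-node instances satisfying $\mathcal{P}$. $\mathsf{size\text{-}pls}(\mathcal{P},t)$ is the minimum size of a PLS for $\mathcal{P}$ of radius at most $t$ on $n$-node labeled graphs. *)

theory Defs
  imports
    Complex_Main
    "Graph_Theory.Graph_Theory"
    "HOL-Library.Multiset"
    "HOL-Library.Extended_Nat"
    "HOL-Library.Extended_Real"
begin

text \<open>
  Graphs are symmetric loop-free digraphs (\<^locale>\<open>pair_graph\<close>) on natural numbers, so that every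
  undirected edge appears as two opposite arcs. Up to isomorphism these are all finite simple
  graphs. The node names carry no meaning: nodes see only their identities.
\<close>

record lgraph =
  graph_of :: "nat pair_pre_digraph"
  weight_of :: "nat \<times> nat \<Rightarrow> nat"
  label_of :: "nat \<Rightarrow> bool list"

abbreviation nodes :: "lgraph \<Rightarrow> nat set" where
  "nodes L \<equiv> pverts (graph_of L)"

definition num_nodes :: "lgraph \<Rightarrow> nat" where
  "num_nodes L = card (nodes L)"

definition valid_lgraph :: "real \<Rightarrow> lgraph \<Rightarrow> bool" where
  "valid_lgraph b L \<longleftrightarrow>
     pair_graph (graph_of L) \<and> connected (with_proj (graph_of L)) \<and>
     (\<forall>(u, v) \<in> parcs (graph_of L). weight_of L (u, v) = weight_of L (v, u)) \<and>
     (\<forall>e \<in> parcs (graph_of L).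
        1 \<le> weight_of L e \<and> real (weight_of L e) \<le> real (num_nodes L) powr b)"

definition valid_ids :: "real \<Rightarrow> lgraph \<Rightarrow> (nat \<Rightarrow> nat) \<Rightarrow> bool" where
  "valid_ids a L ident \<longleftrightarrow>
     inj_on ident (nodes L) \<and>
     (\<forall>v \<in> nodes L. 1 \<le> ident v \<and> real (ident v) \<le> real (num_nodes L) powr a)"

definition instance_of :: "real \<Rightarrow> real \<Rightarrow> lgraph \<Rightarrow> (nat \<Rightarrow> nat) \<Rightarrow> bool" where
  "instance_of a b L ident \<longleftrightarrow> valid_lgraph b L \<and> valid_ids a L ident"

definition hop_ball :: "lgraph \<Rightarrow> nat \<Rightarrow> nat \<Rightarrow> nat set" where
  "hop_ball L r v =
     {u. \<exists>p. pre_digraph.awalk (with_proj (graph_of L)) v p u \<and> length p \<le> r}"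

text \<open>
  What a node learns: its own identity; for every node of its ball the identity, the label, the
  certificate and the multiset of the weights of all incident edges (also those leaving the ball);
  and the subgraph induced by the ball, with edge weights. Since nodes are named by their (distinct)
  identities, isomorphic neighbourhoods give equal views. The number of nodes is not part of it.
\<close>

record view =
  center :: nat
  view_nodes :: "(nat \<times> bool list \<times> bool list \<times> nat multiset) set"
  view_edges :: "(nat \<times> nat \<times> nat) set"

definition view_of ::
    "nat \<Rightarrow> lgraph \<Rightarrow> (nat \<Rightarrow> nat) \<Rightarrow> (nat \<Rightarrow> bool list) \<Rightarrow> nat \<Rightarrow> view" where
  "view_of r L ident cert v =
     \<lparr> center = ident v,
       view_nodes =
         (\<lambda>u. (ident u, label_of L u, cert u,
               image_mset (weight_of L) (mset_set (out_arcs (with_proj (graph_of L)) u))))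
         ` hop_ball L r v,
       view_edges =
         (\<lambda>(x, y). (ident x, ident y, weight_of L (x, y)))
         ` {(x, y) \<in> parcs (graph_of L). x \<in> hop_ball L r v \<and> y \<in> hop_ball L r v} \<rparr>"

text \<open>
  The verifier is an arbitrary function of the view; it may depend on the radius since it belongs
  to a scheme of a given radius.
\<close>

record scheme =
  radius :: nat
  prover :: "lgraph \<Rightarrow> (nat \<Rightarrow> nat) \<Rightarrow> nat \<Rightarrow> bool list"
  verifier :: "view \<Rightarrow> bool"

definition accepts_at ::
    "scheme \<Rightarrow> lgraph \<Rightarrow> (nat \<Rightarrow> nat) \<Rightarrow> (nat \<Rightarrow> bool list) \<Rightarrow> nat \<Rightarrow> bool" where
  "accepts_at S L ident cert v \<longleftrightarrow> verifier S (view_of (radius S) L ident cert v)"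

definition is_pls :: "real \<Rightarrow> real \<Rightarrow> (lgraph \<Rightarrow> bool) \<Rightarrow> scheme \<Rightarrow> bool" where
  "is_pls a b P S \<longleftrightarrow>
     (\<forall>L ident. instance_of a b L ident \<longrightarrow>
        (P L \<longrightarrow> (\<forall>v \<in> nodes L. accepts_at S L ident (prover S L ident) v)) \<and>
        (\<not> P L \<longrightarrow> (\<forall>cert. \<exists>v \<in> nodes L. \<not> accepts_at S L ident cert v)))"

definition pls_size :: "real \<Rightarrow> real \<Rightarrow> (lgraph \<Rightarrow> bool) \<Rightarrow> scheme \<Rightarrow> nat \<Rightarrow> enat" where
  "pls_size a b P S n =
     Sup {enat (length (prover S L ident v)) | L ident v.
            instance_of a b L ident \<and> num_nodes L = n \<and> P L \<and> v \<in> nodes L}"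

text \<open>
  The infimum is a minimum when some scheme exists, and infinite otherwise.
\<close>

definition size_pls :: "real \<Rightarrow> real \<Rightarrow> (lgraph \<Rightarrow> bool) \<Rightarrow> nat \<Rightarrow> nat \<Rightarrow> enat" where
  "size_pls a b P t n = (INF S \<in> {S. is_pls a b P S \<and> radius S \<le> t}. pls_size a b P S n)"

definition weighted_diameter :: "lgraph \<Rightarrow> ereal" where
  "weighted_diameter L =
     (SUP (u, v) \<in> nodes L \<times> nodes L.
        wf_digraph.\<mu> (with_proj (graph_of L)) (\<lambda>e. real (weight_of L e)) u v)"

text \<open>
  Labels are read as binary numerals, least significant bit first.
\<close>

definition DIAM :: "lgraph \<Rightarrow> bool" where
  "DIAM L \<longleftrightarrow>
     (\<forall>v \<in> nodes L.
        ereal (real (horner_sum of_bool (2::nat) (label_of L v))) = weighted_diameter L)"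

end

theory Submission
  imports Defs
begin

text \<open>
  Upper bound. Let \<open>h v u\<close> be the least number of hops of a weight-shortest path from \<open>v\<close> to \<open>u\<close>.
  Node \<open>v\<close> stores the distance to \<open>u\<close> only if \<open>h v u\<close> is congruent to an offset \<open>i u\<close> modulo \<open>t\<close>;
  then every node finds on its shortest path, within \<open>t - 1\<close> hops, either \<open>u\<close> or a node that stores
  its distance to \<open>u\<close>, so with radius \<open>t\<close> it can reconstruct the distance vectors of itself and of
  its neighbours. The only function satisfying the local shortest-path equations everywhere is the
  true distance, so no certificate can cheat. Choosing the offsets one by one so that the potential
  \<open>\<Sum>v. 2 ^ load v\<close> grows by a factor of at most \<open>1 + 1 / t\<close> keeps every load below
  \<open>log 2 n + 2 * n / t\<close>.

  Lower bound. On a weighted cycle of circumference \<open>2 * H\<close> the diameter is \<open>H\<close> iff two nodes are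
  antipodal, and smaller otherwise. Node \<open>i\<close> of the first half is placed at \<open>2 * i\<close> or \<open>2 * i + 1\<close>
  according to a bit of a set \<open>S\<close>, and node \<open>i\<close> of the second half at \<open>H + 2 * i\<close> or \<open>H + 2 * i + 1\<close>
  according to the opposite bit of a set \<open>T\<close>: the diameter is \<open>H - 1\<close> iff \<open>S = T\<close>. If the bits only
  vary away from two arcs of length about \<open>2 * t\<close>, the certificates on these arcs must
  distinguish all the sets \<open>S\<close>, and there are \<open>2 ^ k\<close> of them with \<open>k\<close> linear in \<open>n\<close>. This even
  gives a lower bound of order \<open>n / t\<close>.
\<close>

section \<open>Weighted walks, and local checks on claimed distances\<close>

section \<open>Distances from locally consistent estimates\<close>

text \<open>Hops and weight are tracked separately: the radius limits hops, while distances are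
  weights. The carrier is a bare set of weighted arcs, so that the same notions apply to a whole
  graph and to the part of it seen in a view.\<close>

inductive walk :: "('a \<times> 'a \<times> nat) set \<Rightarrow> 'a \<Rightarrow> nat \<Rightarrow> nat \<Rightarrow> 'a \<Rightarrow> bool" for E where
  walk_refl: "walk E x 0 0 x"
| walk_step: "(x, y, c) \<in> E \<Longrightarrow> walk E y k W z \<Longrightarrow> walk E x (Suc k) (c + W) z"

lemma walk_trans: "walk E x k W y \<Longrightarrow> walk E y l V z \<Longrightarrow> walk E x (k + l) (W + V) z"
  by (induction rule: walk.induct) (auto simp: add.assoc intro: walk.intros)

lemma walk_mono: "walk E x k W y \<Longrightarrow> E \<subseteq> E' \<Longrightarrow> walk E' x k W y"
  by (induction rule: walk.induct) (auto intro: walk.intros)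

text \<open>A potential that drops by at most the weight of each arc bounds walk weights from below.
  This is the tool for lower bounds on distances in cycles.\<close>

lemma walk_lipschitz:
  assumes "\<And>x y w. (x, y, w) \<in> E \<Longrightarrow> g x \<le> w + g y"
  shows "walk E x k W z \<Longrightarrow> (g x :: nat) \<le> W + g z"
  by (induction rule: walk.induct) (use assms in fastforce)+

definition dist_in :: "('a \<times> 'a \<times> nat) set \<Rightarrow> 'a \<Rightarrow> 'a \<Rightarrow> nat" where
  "dist_in E x y = (LEAST W. \<exists>k. walk E x k W y)"

text \<open>This is not the hop distance: only walks of least weight compete.\<close>

definition hops_in :: "('a \<times> 'a \<times> nat) set \<Rightarrow> 'a \<Rightarrow> 'a \<Rightarrow> nat" where
  "hops_in E x y = (LEAST k. walk E x k (dist_in E x y) y)"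

lemma dist_in_le: "walk E x k W y \<Longrightarrow> dist_in E x y \<le> W"
  unfolding dist_in_def by (auto intro: Least_le)

text \<open>
  The distance claims a node can derive from its ball: walk at most \<open>s\<close> steps to a node \<open>z\<close> and use
  the table \<open>D z\<close>, or the trivial fact that \<open>z\<close> is at distance 0 from itself.
\<close>

definition known :: "('a \<times> 'a \<times> nat) set \<Rightarrow> ('a \<Rightarrow> ('a \<times> nat) set) \<Rightarrow> nat \<Rightarrow> 'a \<Rightarrow> ('a \<times> nat) set" where
  "known E D s v = {(u, W + d) | u W d k z. k \<le> s \<and> walk E v k W z \<and> (u, d) \<in> insert (z, 0) (D z)}"

definition targets :: "('a \<times> 'a \<times> nat) set \<Rightarrow> ('a \<Rightarrow> ('a \<times> nat) set) \<Rightarrow> nat \<Rightarrow> 'a \<Rightarrow> 'a set" where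
  "targets E D s v = fst ` known E D s v"

definition est :: "('a \<times> 'a \<times> nat) set \<Rightarrow> ('a \<Rightarrow> ('a \<times> nat) set) \<Rightarrow> nat \<Rightarrow> 'a \<Rightarrow> 'a \<Rightarrow> nat" where
  "est E D s v u = (LEAST e. (u, e) \<in> known E D s v)"

text \<open>Besides the Bellman inequality, some neighbour must attain equality. Equality excludes
  underestimates, the inequality excludes overestimates. Equal target sets at neighbours make the
  target set global.\<close>

definition bellman_at :: "('a \<times> 'a \<times> nat) set \<Rightarrow> ('a \<Rightarrow> ('a \<times> nat) set) \<Rightarrow> nat \<Rightarrow> 'a \<Rightarrow> bool" where
  "bellman_at E D s v \<longleftrightarrow>
     (\<forall>w c. (v, w, c) \<in> E \<longrightarrow> targets E D s w = targets E D s v) \<and>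
     (\<forall>u \<in> targets E D s v. u \<noteq> v \<longrightarrow>
        (\<forall>w c. (v, w, c) \<in> E \<longrightarrow> est E D s v u \<le> c + est E D s w u) \<and>
        (\<exists>w c. (v, w, c) \<in> E \<and> est E D s v u = c + est E D s w u))"

text \<open>\<open>lab\<close> is the claimed diameter and \<open>r\<close> the claimed end of a
  diametral pair. Every node checks that no distance exceeds the claim; attainment is checked only
  at the node named by \<open>r\<close>, and the membership of \<open>r v\<close> in the targets
  ensures that this node exists.\<close>

definition diam_check_at ::
    "('a \<times> 'a \<times> nat) set \<Rightarrow> ('a \<Rightarrow> ('a \<times> nat) set) \<Rightarrow> ('a \<Rightarrow> nat) \<Rightarrow> ('a \<Rightarrow> 'a) \<Rightarrow> nat \<Rightarrow> 'a \<Rightarrow> bool" where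
  "diam_check_at E D lab r s v \<longleftrightarrow>
     bellman_at E D s v \<and>
     (\<forall>w c. (v, w, c) \<in> E \<longrightarrow> lab w = lab v \<and> r w = r v) \<and>
     (\<forall>u \<in> targets E D s v. est E D s v u \<le> lab v) \<and>
     r v \<in> targets E D s v \<and>
     (r v = v \<longrightarrow> (\<exists>u \<in> targets E D s v. est E D s v u = lab v))"

lemma self_in_known: "(v, 0) \<in> known E D s v"
  unfolding known_def using walk_refl[of E v] by fastforce

lemma est_self: "est E D s v v = 0"
  unfolding est_def using self_in_known by (metis Least_eq_0)

section \<open>Distances are the only solution of the local equations\<close>

locale wgraph =
  fixes N :: "'a set" and E :: "('a \<times> 'a \<times> nat) set"
  assumes finite_N: "finite N" and N_nonempty: "N \<noteq> {}"
    and E_wf: "(x, y, c) \<in> E \<Longrightarrow> x \<in> N \<and> y \<in> N \<and> 1 \<le> c"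
    and E_conn: "x \<in> N \<Longrightarrow> y \<in> N \<Longrightarrow> \<exists>k W. walk E x k W y"
begin

abbreviation "dst \<equiv> dist_in E"
abbreviation "hops \<equiv> hops_in E"

definition diam :: nat where
  "diam = Max ((\<lambda>(x, y). dst x y) ` (N \<times> N))"

lemma walk_in_N: "walk E x k W y \<Longrightarrow> x \<in> N \<Longrightarrow> y \<in> N"
  by (induction rule: walk.induct) (auto dest: E_wf)

lemma walk_dist: "x \<in> N \<Longrightarrow> y \<in> N \<Longrightarrow> \<exists>k. walk E x k (dst x y) y"
  unfolding dist_in_def by (rule LeastI_ex) (use E_conn in blast)

lemma walk_hops: "x \<in> N \<Longrightarrow> y \<in> N \<Longrightarrow> walk E x (hops x y) (dst x y) y"
  unfolding hops_in_def by (rule LeastI_ex) (rule walk_dist)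

lemma hops_le: "walk E x k (dst x y) y \<Longrightarrow> hops x y \<le> k"
  unfolding hops_in_def by (rule Least_le)

lemma dist_le_diam: "x \<in> N \<Longrightarrow> y \<in> N \<Longrightarrow> dst x y \<le> diam"
  unfolding diam_def using finite_N by (intro Max_ge) auto

lemma diam_attained: "\<exists>x \<in> N. \<exists>y \<in> N. dst x y = diam"
proof -
  have "diam \<in> (\<lambda>(x, y). dst x y) ` (N \<times> N)"
    unfolding diam_def using finite_N N_nonempty by (intro Max_in) auto
  then obtain x y where "x \<in> N" "y \<in> N" "diam = dst x y" by auto
  then show ?thesis by metis
qed

lemma dist_self: "dst x x = 0"
  using dist_in_le[OF walk_refl] by auto

lemma dist_edge_le:
  assumes "(v, w, c) \<in> E" "u \<in> N"
  shows "dst v u \<le> c + dst w u"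
proof -
  have "w \<in> N" using E_wf[OF assms(1)] by simp
  from dist_in_le[OF walk_step[OF assms(1) walk_hops[OF this assms(2)]]] show ?thesis .
qed

text \<open>Removing the first arc of a shortest walk with fewest hops leaves such a walk from the
  next node. So along it \<open>hops\<close> drops by exactly one per step, which makes residues of
  \<open>hops\<close> usable as markers.\<close>

lemma next_hop:
  assumes "v \<in> N" "u \<in> N" "u \<noteq> v"
  shows "\<exists>w c. (v, w, c) \<in> E \<and> dst v u = c + dst w u \<and> hops v u = Suc (hops w u)"
proof -
  from walk_hops[OF assms(1,2)] show ?thesis
  proof cases
    case (walk_step w c k W)
    have w: "w \<in> N" using E_wf walk_step by blast
    have 1: "dst w u \<le> W" using walk_step dist_in_le by metis
    have 2: "dst v u \<le> c + dst w u" using dist_edge_le walk_step assms by blast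
    have W: "dst w u = W" using 1 2 walk_step by simp
    then have 3: "hops w u \<le> k" using hops_le walk_step by metis
    have "walk E v (Suc (hops w u)) (c + dst w u) u"
      using walk_step walk_hops[OF w assms(2)] walk.walk_step by metis
    then have "hops v u \<le> Suc (hops w u)" using hops_le W walk_step by metis
    then show ?thesis using walk_step 3 W by auto
  qed (use assms in simp)
qed

lemma targets_const:
  assumes "\<And>v. v \<in> N \<Longrightarrow> bellman_at E D s v" "v \<in> N" "w \<in> N"
  shows "targets E D s w = targets E D s v"
proof -
  have "walk E x k W y \<Longrightarrow> x \<in> N \<Longrightarrow> targets E D s y = targets E D s x" for x k W y
  proof (induction rule: walk.induct)
    case (walk_step x y c k W z)
    then have "y \<in> N" using E_wf by blast
    then show ?case using walk_step assms(1)[of x] unfolding bellman_at_def by metis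
  qed auto
  then show ?thesis using E_conn assms(2,3) by metis
qed

text \<open>Certificates could list a nonexistent identity. A node with the least estimate for it
  would need a neighbour with a smaller one, as weights are positive.\<close>

lemma bellman_target_in_N:
  assumes B: "\<And>v. v \<in> N \<Longrightarrow> bellman_at E D s v" and v: "v \<in> N" "u \<in> targets E D s v"
  shows "u \<in> N"
proof (rule ccontr)
  assume u: "u \<notin> N"
  obtain x where x: "x \<in> N" "\<And>y. y \<in> N \<Longrightarrow> est E D s x u \<le> est E D s y u"
    using ex_min_if_finite[of "(\<lambda>y. est E D s y u) ` N"] finite_N N_nonempty
    by (metis (no_types, lifting) arg_min_if_finite(1) arg_min_least)
  have "u \<in> targets E D s x" using targets_const[OF B v(1) x(1)] v by simp
  then obtain w c where "(x, w, c) \<in> E" "est E D s x u = c + est E D s w u"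
    using B[OF x(1)] u x(1) unfolding bellman_at_def by metis
  then show False using x(2)[of w] E_wf[of x w c] by simp
qed

lemma bellman_targets:
  assumes B: "\<And>v. v \<in> N \<Longrightarrow> bellman_at E D s v" and v: "v \<in> N"
  shows "targets E D s v = N"
proof -
  have "u \<in> targets E D s v" if "u \<in> N" for u
    using targets_const[OF B v that] self_in_known[of u E D s] unfolding targets_def
    by (metis fst_conv imageI)
  then show ?thesis using bellman_target_in_N[OF B v] by auto
qed

text \<open>The inequalities, summed along a walk, bound the estimate by the weight of the walk.
  Conversely, following the equalities strictly decreases the estimate, so the descent ends at
  \<open>u\<close> and traces a walk whose weight is the estimate.\<close>

lemma bellman_est:
  assumes B: "\<And>v. v \<in> N \<Longrightarrow> bellman_at E D s v" and v: "v \<in> N" and u: "u \<in> N"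
  shows "est E D s v u = dst v u"
proof (rule antisym)
  have "walk E x k W y \<Longrightarrow> x \<in> N \<Longrightarrow> est E D s x y \<le> W" for x k W y
  proof (induction rule: walk.induct)
    case (walk_refl x)
    then show ?case by (simp add: est_self)
  next
    case (walk_step x y c k W z)
    then have y: "y \<in> N" using E_wf by blast
    then have "z \<in> targets E D s x" using bellman_targets[OF B] walk_step walk_in_N by blast
    then have "x \<noteq> z \<Longrightarrow> est E D s x z \<le> c + est E D s y z"
      using B[OF walk_step.prems] walk_step unfolding bellman_at_def by metis
    then show ?case using walk_step y est_self[of E D s z] by (cases "x = z") auto
  qed
  then show "est E D s v u \<le> dst v u" using walk_hops[OF v u] v by blast
  have "\<exists>k. walk E v k (est E D s v u) u" if "v \<in> N" for v
    using that
  proof (induction "est E D s v u" arbitrary: v rule: less_induct)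
    case less
    show ?case
    proof (cases "u = v")
      case True
      then show ?thesis using walk_refl[of E v] est_self[of E D s v] by auto
    next
      case False
      then obtain w c where w: "(v, w, c) \<in> E" "est E D s v u = c + est E D s w u"
        using B[OF less.prems] bellman_targets[OF B less.prems] u unfolding bellman_at_def by metis
      then have "w \<in> N" "est E D s w u < est E D s v u" using E_wf[OF w(1)] by auto
      then show ?thesis using less.hyps walk.walk_step[OF w(1)] w(2) by metis
    qed
  qed
  then show "dst v u \<le> est E D s v u" using v dist_in_le by metis
qed

text \<open>Connectivity makes label and root global. The label bounds all distances, and the root,
  being an actual node, witnesses that it is one of them.\<close>

lemma diam_check_sound:
  assumes C: "\<And>v. v \<in> N \<Longrightarrow> diam_check_at E D lab r s v" and v: "v \<in> N"
  shows "lab v = diam"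
proof -
  have B: "bellman_at E D s x" if "x \<in> N" for x
    using C[OF that] unfolding diam_check_at_def by blast
  have "walk E x k W y \<Longrightarrow> x \<in> N \<Longrightarrow> lab y = lab x \<and> r y = r x" for x k W y
  proof (induction rule: walk.induct)
    case (walk_step x y c k W z)
    then have "y \<in> N" using E_wf by blast
    then show ?case using walk_step C[of x] unfolding diam_check_at_def by metis
  qed auto
  then have const: "lab x = lab v" "r x = r v" if "x \<in> N" for x
    using E_conn[OF v that] v by metis+
  have T: "targets E D s x = N" if "x \<in> N" for x
    by (rule bellman_targets) (use B that in auto)
  have D: "est E D s x u = dst x u" if "x \<in> N" "u \<in> N" for x u
    by (rule bellman_est) (use B that in auto)
  have le: "dst x y \<le> lab v" if "x \<in> N" "y \<in> N" for x y
    using C[OF that(1)] T[OF that(1)] D[OF that] that(2) const(1)[OF that(1)]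
    unfolding diam_check_at_def by metis
  have rN: "r v \<in> N" using C[OF v] T[OF v] unfolding diam_check_at_def by blast
  then obtain u where u: "u \<in> N" "dst (r v) u = lab v"
    using C[OF rN] T[OF rN] D[OF rN] const[OF rN] unfolding diam_check_at_def by metis
  obtain x y where "x \<in> N" "y \<in> N" "dst x y = diam" using diam_attained by blast
  then show ?thesis using le u dist_le_diam[OF rN u(1)] by force
qed

text \<open>For the honest tables every derivable claim is the weight of some walk, hence never
  below the distance. The distance itself is derivable because \<open>Suc s\<close> consecutive hop
  counts meet every residue.\<close>

lemma est_complete:
  assumes D: "\<And>z. z \<in> N \<Longrightarrow> D z = {(u, dst z u) | u. u \<in> N \<and> hops z u mod Suc s = i u}"
    and i: "\<And>u. u \<in> N \<Longrightarrow> i u \<le> s" and v: "v \<in> N"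
  shows "targets E D s v = N" and "u \<in> N \<Longrightarrow> est E D s v u = dst v u"
proof -
  have sound: "u \<in> N \<and> dst v u \<le> e" if "(u, e) \<in> known E D s v" for u e
  proof -
    from that obtain W d k z where z: "walk E v k W z" "e = W + d" "(u, d) \<in> insert (z, 0) (D z)"
      unfolding known_def by auto
    have "z \<in> N" using walk_in_N z v by blast
    then have "u \<in> N \<and> d = dst z u" using z D[of z] dist_self by auto
    then show ?thesis
      using z dist_in_le[OF walk_trans[OF z(1) walk_hops]] \<open>z \<in> N\<close> by auto
  qed
  \<comment> \<open>Follow the shortest path for at most \<open>m\<close> hops, stopping at
    \<open>u\<close> or at the first node that stores its distance to \<open>u\<close>.\<close>
  have stop: "\<exists>k W z. k \<le> m \<and> walk E v k W z \<and> z \<in> N \<and> dst v u = W + dst z u \<and>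
      (z = u \<or> hops z u mod Suc s = i u)"
    if "v \<in> N" "u \<in> N" "hops v u \<le> m \<or> (\<exists>j \<le> m. (hops v u - j) mod Suc s = i u)" for v u m
    using that
  proof (induction m arbitrary: v)
    case 0
    then have "v = u \<or> hops v u mod Suc s = i u"
      using next_hop[of v u] by (metis diff_zero le_0_eq nat.distinct(1))
    then have "(0::nat) \<le> 0 \<and> walk E v 0 0 v \<and> v \<in> N \<and> dst v u = 0 + dst v u \<and> (v = u \<or> hops v u mod Suc s = i u)"
      using walk_refl[of E v] 0 by simp
    then show ?case by blast
  next
    case (Suc m)
    show ?case
    proof (cases "v = u \<or> hops v u mod Suc s = i u")
      case True
      then have "0 \<le> Suc m \<and> walk E v 0 0 v \<and> v \<in> N \<and> dst v u = 0 + dst v u \<and> (v = u \<or> hops v u mod Suc s = i u)"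
        using walk_refl[of E v] Suc.prems by simp
      then show ?thesis by blast
    next
      case False
      then obtain w c where w: "(v, w, c) \<in> E" "dst v u = c + dst w u" "hops v u = Suc (hops w u)"
        using next_hop[of v u] Suc.prems by metis
      have "hops w u \<le> m \<or> (\<exists>j \<le> m. (hops w u - j) mod Suc s = i u)"
        using Suc.prems(3)
      proof
        assume "\<exists>j \<le> Suc m. (hops v u - j) mod Suc s = i u"
        then obtain j where j: "j \<le> Suc m" "(hops v u - j) mod Suc s = i u" by blast
        then have "j \<noteq> 0" using False by (metis diff_zero)
        then have "j - 1 \<le> m" "(hops w u - (j - 1)) mod Suc s = i u" using j w(3) by auto
        then show ?thesis by blast
      qed (use w in simp)
      moreover have "w \<in> N" using E_wf w(1) by blast
      ultimately obtain k W z where z: "k \<le> m" "walk E w k W z" "z \<in> N" "dst w u = W + dst z u"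
          "z = u \<or> hops z u mod Suc s = i u"
        using Suc.IH Suc.prems(2) by blast
      then show ?thesis using walk.walk_step[OF w(1) z(2)] w(2)
        by (intro exI[of _ "Suc k"] exI[of _ "c + W"] exI[of _ z]) auto
    qed
  qed
  have compl: "(u, dst v u) \<in> known E D s v" if u: "u \<in> N" for u
  proof -
    have "hops v u \<le> s \<or> (\<exists>j \<le> s. (hops v u - j) mod Suc s = i u)"
    proof (cases "hops v u \<le> s")
      case False
      then have h: "\<not> hops v u \<le> s" .
      \<comment> \<open>\<open>j\<close> is the residue of \<open>hops v u - i u\<close> modulo
        \<open>Suc s\<close>, so \<open>j\<close> steps along the path lead to residue
        \<open>i u\<close>. As \<open>hops v u\<close> exceeds \<open>s\<close>, hence
        \<open>j\<close>, the subtraction below is not truncated.\<close>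
      define j where "j = (hops v u + Suc s - i u) mod Suc s"
      have "j \<le> s" unfolding j_def using less_Suc_eq_le by fastforce
      moreover have "(hops v u - j) mod Suc s = i u"
      proof -
        define q where "q = (hops v u + Suc s - i u) div Suc s"
        have e: "hops v u + Suc s - i u = q * Suc s + j" unfolding q_def j_def by (simp only: div_mult_mod_eq)
        have "(hops v u - j) + Suc s = i u + q * Suc s" using e i[OF u] \<open>j \<le> s\<close> h by linarith
        then have "((hops v u - j) + Suc s) mod Suc s = (i u + q * Suc s) mod Suc s"
          by (simp only:)
        then have "(hops v u - j) mod Suc s = i u mod Suc s"
          by (simp only: mod_mult_self1 mod_add_self2)
        then show ?thesis using i[OF u] by simp
      qed
      ultimately show ?thesis by blast
    qed simp
    from stop[OF v u this] obtain k W z where z: "k \<le> s" "walk E v k W z" "z \<in> N"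
      "dst v u = W + dst z u" "z = u \<or> hops z u mod Suc s = i u" by blast
    have "(u, dst z u) \<in> insert (z, 0) (D z)"
      using z(3,5) D[of z] u dist_self by auto
    then show ?thesis unfolding known_def using z by blast
  qed
  show "targets E D s v = N"
    unfolding targets_def using sound compl by force
  show "u \<in> N \<Longrightarrow> est E D s v u = dst v u"
    unfolding est_def using sound compl by (auto intro: Least_equality)
qed

lemma diam_check_complete:
  assumes D: "\<And>z. z \<in> N \<Longrightarrow> D z = {(u, dst z u) | u. u \<in> N \<and> hops z u mod Suc s = i u}"
    and i: "\<And>u. u \<in> N \<Longrightarrow> i u \<le> s"
    and r: "\<And>z. z \<in> N \<Longrightarrow> r z = r0" "r0 \<in> N" "\<exists>y \<in> N. dst r0 y = diam"
    and lab: "\<And>z. z \<in> N \<Longrightarrow> lab z = diam" and v: "v \<in> N"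
  shows "diam_check_at E D lab r s v"
proof -
  have T: "targets E D s x = N" if "x \<in> N" for x
    by (rule est_complete(1)[of D s i]) (use D i that in auto)
  have est: "est E D s x u = dst x u" if "x \<in> N" "u \<in> N" for x u
    by (rule est_complete(2)[of D s i]) (use D i that in auto)
  have nbr: "w \<in> N" if "(v, w, c) \<in> E" for w c
    using E_wf that by blast
  have "bellman_at E D s v"
    unfolding bellman_at_def
  proof (intro conjI allI impI ballI)
    fix w c assume "(v, w, c) \<in> E"
    then show "targets E D s w = targets E D s v" using T[OF v] T[OF nbr] by simp
  next
    fix u w c assume "u \<in> targets E D s v" and w: "(v, w, c) \<in> E"
    then have "u \<in> N" using T[OF v] by simp
    then show "est E D s v u \<le> c + est E D s w u"
      using est[OF v] est[OF nbr[OF w]] dist_edge_le[OF w] by simp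
  next
    fix u assume "u \<in> targets E D s v" and uv: "u \<noteq> v"
    then have u: "u \<in> N" using T[OF v] by simp
    obtain w c where w: "(v, w, c) \<in> E" "dst v u = c + dst w u"
      using next_hop[OF v u uv] by blast
    then have "est E D s v u = c + est E D s w u"
      using est[OF v u] est[OF nbr[OF w(1)] u] by simp
    then show "\<exists>w c. (v, w, c) \<in> E \<and> est E D s v u = c + est E D s w u"
      using w(1) by blast
  qed
  moreover have "\<forall>u \<in> targets E D s v. est E D s v u \<le> lab v"
    using T[OF v] est[OF v] lab[OF v] dist_le_diam[OF v] by simp
  moreover have "r v = v \<longrightarrow> (\<exists>u \<in> targets E D s v. est E D s v u = lab v)"
  proof
    assume "r v = v"
    then have "v = r0" using r(1)[OF v] by simp
    then obtain u where "u \<in> N" "dst v u = diam" using r(3) by blast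
    then show "\<exists>u \<in> targets E D s v. est E D s v u = lab v"
      using T[OF v] est[OF v] lab[OF v] by auto
  qed
  moreover have "r v \<in> targets E D s v" using T[OF v] r(1)[OF v] r(2) by simp
  moreover have "\<forall>w c. (v, w, c) \<in> E \<longrightarrow> lab w = lab v \<and> r w = r v"
    using lab[OF v] lab[OF nbr] r(1)[OF v] r(1)[OF nbr] by metis
  ultimately show ?thesis unfolding diam_check_at_def by blast
qed

end

section \<open>Transfer between labelled graphs and sets of named weighted arcs\<close>

section \<open>Labelled graphs and views\<close>

text \<open>With the identity assignment for \<open>f\<close> this is the graph as the nodes see it;
  with the identity function it is the graph on its own node names.\<close>

definition id_arcs :: "lgraph \<Rightarrow> (nat \<Rightarrow> nat) \<Rightarrow> (nat \<times> nat \<times> nat) set" where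
  "id_arcs L f = (\<lambda>(x, y). (f x, f y, weight_of L (x, y))) ` parcs (graph_of L)"

abbreviation is_awalk :: "lgraph \<Rightarrow> nat \<Rightarrow> (nat \<times> nat) list \<Rightarrow> nat \<Rightarrow> bool" where
  "is_awalk L \<equiv> pre_digraph.awalk (with_proj (graph_of L))"

lemma is_awalk_Nil: "is_awalk L u [] v \<longleftrightarrow> u = v \<and> u \<in> nodes L"
  by (auto simp: pre_digraph.awalk_def cas_with_proj_eq)

lemma is_awalk_Cons:
  assumes "pair_wf_digraph (graph_of L)"
  shows "is_awalk L u ((x, y) # p) v \<longleftrightarrow> u = x \<and> (x, y) \<in> parcs (graph_of L) \<and> is_awalk L y p v"
proof -
  interpret pair_wf_digraph "graph_of L" by fact
  show ?thesis
    by (auto simp: pre_digraph.awalk_def cas_with_proj_eq dest: in_arcsD1 in_arcsD2)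
qed

lemma awalk_imp_walk:
  assumes "pair_wf_digraph (graph_of L)" "is_awalk L u p v"
  shows "walk (id_arcs L f) (f u) (length p) (sum_list (map (weight_of L) p)) (f v)"
  using assms(2)
proof (induction p arbitrary: u)
  case Nil
  then show ?case by (auto simp: is_awalk_Nil intro: walk_refl)
next
  case (Cons e p)
  obtain x y where e: "e = (x, y)" by (cases e)
  from Cons have "u = x" "(x, y) \<in> parcs (graph_of L)" "is_awalk L y p v"
    unfolding e is_awalk_Cons[OF assms(1)] by auto
  then show ?case
    using Cons.IH[of y] by (auto simp: e id_arcs_def intro!: walk_step)
qed

lemma walk_imp_awalk:
  assumes "pair_wf_digraph (graph_of L)" and inj: "inj_on f (nodes L)"
  shows "walk (id_arcs L f) x k W z \<Longrightarrow> x = f u \<Longrightarrow> u \<in> nodes L \<Longrightarrow>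
    \<exists>p v. is_awalk L u p v \<and> v \<in> nodes L \<and> z = f v \<and> length p = k \<and> sum_list (map (weight_of L) p) = W"
proof (induction arbitrary: u rule: walk.induct)
  case (walk_refl x)
  then show ?case by (intro exI[of _ "[]"]) (auto simp: is_awalk_Nil)
next
  case (walk_step x y c k W z)
  interpret pair_wf_digraph "graph_of L" by fact
  from walk_step obtain x' y' where a: "x = f x'" "y = f y'" "c = weight_of L (x', y')"
    "(x', y') \<in> parcs (graph_of L)" by (auto simp: id_arcs_def)
  have N: "x' \<in> nodes L" "y' \<in> nodes L" using a(4) in_arcsD1 in_arcsD2 by auto
  have u: "x' = u" using inj a(1) walk_step.prems N by (auto dest: inj_onD)
  from walk_step.IH[OF a(2) N(2)] obtain p v where "is_awalk L y' p v" "v \<in> nodes L" "z = f v" "length p = k"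
    "sum_list (map (weight_of L) p) = W" by blast
  then show ?case
    using a u by (intro exI[of _ "(x', y') # p"] exI[of _ v]) (auto simp: is_awalk_Cons[OF assms(1)])
qed

lemma wgraph_id_arcs:
  assumes "valid_lgraph b L" "inj_on f (nodes L)"
  shows "wgraph (f ` nodes L) (id_arcs L f)"
proof -
  have pg: "pair_graph (graph_of L)" and con: "connected (with_proj (graph_of L))"
    and wt: "\<And>e. e \<in> parcs (graph_of L) \<Longrightarrow> 1 \<le> weight_of L e"
    using assms(1) unfolding valid_lgraph_def by auto
  interpret pair_graph "graph_of L" by fact
  have wf: "pair_wf_digraph (graph_of L)" by unfold_locales
  have sc: "strongly_connected (with_proj (mk_symmetric (with_proj (graph_of L))))"
    using con unfolding connected_def .
  show ?thesis
  proof
    show "finite (f ` nodes L)" using pair_finite_verts by simp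
    show "f ` nodes L \<noteq> {}" using sc unfolding strongly_connected_def by auto
    show "x \<in> f ` nodes L \<and> y \<in> f ` nodes L \<and> 1 \<le> c" if "(x, y, c) \<in> id_arcs L f" for x y c
      using that wt unfolding id_arcs_def by (auto dest: in_arcsD1 in_arcsD2)
    fix x y assume "x \<in> f ` nodes L" "y \<in> f ` nodes L"
    then obtain u v where uv: "u \<in> nodes L" "v \<in> nodes L" "x = f u" "y = f v" by auto
    then have "reachable (with_proj (mk_symmetric (with_proj (graph_of L)))) u v"
      using sc unfolding strongly_connected_def by simp
    \<comment> \<open>Connectedness is stated for the symmetric closure; the arcs are already
      symmetric, so reachability is the same.\<close>
    then have "reachable (with_proj (graph_of L)) u v"
      using reachable_mk_symmetric_eq sym_arcs by blast
    then obtain p where "is_awalk L u p v" using reachable_awalk by blast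
    then show "\<exists>k W. walk (id_arcs L f) x k W y"
      using awalk_imp_walk[OF wf] uv by blast
  qed
qed

text \<open>The infimum \<open>\<mu>\<close> over arc walks is attained by the walk realising the
  least weight.\<close>

lemma mu_eq_dist:
  assumes "valid_lgraph b L" "inj_on f (nodes L)" "u \<in> nodes L" "v \<in> nodes L"
  shows "wf_digraph.\<mu> (with_proj (graph_of L)) (\<lambda>e. real (weight_of L e)) u v =
    ereal (real (dist_in (id_arcs L f) (f u) (f v)))"
proof -
  interpret pair_graph "graph_of L" using assms(1) unfolding valid_lgraph_def by simp
  have wf: "pair_wf_digraph (graph_of L)" by unfold_locales
  interpret W: wgraph "f ` nodes L" "id_arcs L f" using wgraph_id_arcs assms(1,2) .
  have cost: "awalk_cost (\<lambda>e. real (weight_of L e)) p = real (sum_list (map (weight_of L) p))" for p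
    by (induction p) auto
  obtain p v' where p: "is_awalk L u p v'" "v' \<in> nodes L" "f v = f v'"
      "sum_list (map (weight_of L) p) = W.dst (f u) (f v)"
    using walk_imp_awalk[OF wf assms(2) W.walk_hops[of "f u" "f v"] refl assms(3)] assms(3,4) by auto
  have "v' = v" using p(2,3) assms(2,4) by (auto dest: inj_onD)
  show ?thesis
    unfolding \<mu>_def
  proof (rule antisym)
    show "(INF p\<in>{p. is_awalk L u p v}. ereal (awalk_cost (\<lambda>e. real (weight_of L e)) p))
      \<le> ereal (real (W.dst (f u) (f v)))"
      using p \<open>v' = v\<close> cost by (intro INF_lower2[of p]) auto
    show "ereal (real (W.dst (f u) (f v))) \<le>
      (INF p\<in>{p. is_awalk L u p v}. ereal (awalk_cost (\<lambda>e. real (weight_of L e)) p))"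
    proof (rule INF_greatest)
      fix p assume "p \<in> {p. is_awalk L u p v}"
      then have "is_awalk L u p v" by simp
      from dist_in_le[OF awalk_imp_walk[OF wf this, of f]]
      show "ereal (real (W.dst (f u) (f v))) \<le> ereal (awalk_cost (\<lambda>e. real (weight_of L e)) p)"
        unfolding cost by simp
    qed
  qed
qed

lemma weighted_diameter_eq:
  assumes "valid_lgraph b L" "inj_on f (nodes L)"
  shows "weighted_diameter L = ereal (real (wgraph.diam (f ` nodes L) (id_arcs L f)))"
proof -
  interpret W: wgraph "f ` nodes L" "id_arcs L f" using wgraph_id_arcs assms .
  have m: "wf_digraph.\<mu> (with_proj (graph_of L)) (\<lambda>e. real (weight_of L e)) u v =
    ereal (real (W.dst (f u) (f v)))" if "u \<in> nodes L" "v \<in> nodes L" for u v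
    using mu_eq_dist assms that by blast
  obtain u v where uv: "u \<in> nodes L" "v \<in> nodes L" "W.dst (f u) (f v) = W.diam"
    using W.diam_attained by auto
  show ?thesis
    unfolding weighted_diameter_def
  proof (rule antisym)
    show "(SUP (u, v)\<in>nodes L \<times> nodes L.
        wf_digraph.\<mu> (with_proj (graph_of L)) (\<lambda>e. real (weight_of L e)) u v) \<le> ereal (real W.diam)"
      using m W.dist_le_diam by (intro SUP_least) auto
    show "ereal (real W.diam) \<le> (SUP (u, v)\<in>nodes L \<times> nodes L.
        wf_digraph.\<mu> (with_proj (graph_of L)) (\<lambda>e. real (weight_of L e)) u v)"
      using m uv by (intro SUP_upper2[of "(u, v)"]) auto
  qed
qed

abbreviation label_val :: "bool list \<Rightarrow> nat" where
  "label_val l \<equiv> horner_sum of_bool (2::nat) l"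

lemma DIAM_iff:
  assumes "valid_lgraph b L" "inj_on f (nodes L)"
  shows "DIAM L \<longleftrightarrow> (\<forall>v \<in> nodes L. label_val (label_of L v) = wgraph.diam (f ` nodes L) (id_arcs L f))"
  unfolding DIAM_def weighted_diameter_eq[OF assms] by simp

section \<open>Hop balls, and running the check inside a view\<close>

lemma hop_ball_self: "v \<in> nodes L \<Longrightarrow> v \<in> hop_ball L r v"
  unfolding hop_ball_def by (auto simp: is_awalk_Nil intro!: exI[of _ "[]"])

lemma hop_ball_mono: "r \<le> r' \<Longrightarrow> hop_ball L r v \<subseteq> hop_ball L r' v"
  unfolding hop_ball_def by auto

lemma hop_ball_nodes: "pair_wf_digraph (graph_of L) \<Longrightarrow> hop_ball L r v \<subseteq> nodes L"
  unfolding hop_ball_def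
  by (auto dest: wf_digraph.awalk_last_in_verts[rotated] simp: wf_digraph_wp_iff)

lemma hop_ball_step:
  assumes wf: "pair_wf_digraph (graph_of L)" and "x \<in> hop_ball L r v" "(x, y) \<in> parcs (graph_of L)"
  shows "y \<in> hop_ball L (Suc r) v"
proof -
  interpret pair_wf_digraph "graph_of L" by fact
  from assms obtain p where p: "is_awalk L v p x" "length p \<le> r" unfolding hop_ball_def by auto
  have "is_awalk L x [(x, y)] y"
    using assms(3) in_arcsD2 by (simp add: is_awalk_Cons[OF wf] is_awalk_Nil)
  then have "is_awalk L v (p @ [(x, y)]) y" using p(1) by (simp add: awalk_appendI)
  then show ?thesis using p(2) unfolding hop_ball_def by (auto intro!: exI[of _ "p @ [(x, y)]"])
qed

text \<open>A view is a set of tuples; the choice is unique for identities of nodes in the ball,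
  since identities are injective.\<close>

definition view_label :: "view \<Rightarrow> nat \<Rightarrow> bool list" where
  "view_label V z = (SOME l. \<exists>c m. (z, l, c, m) \<in> view_nodes V)"

definition view_cert :: "view \<Rightarrow> nat \<Rightarrow> bool list" where
  "view_cert V z = (SOME c. \<exists>l m. (z, l, c, m) \<in> view_nodes V)"

lemma view_label_cert:
  assumes "inj_on ident (nodes L)" "pair_wf_digraph (graph_of L)" "z \<in> hop_ball L t v"
  shows "view_label (view_of t L ident cert v) (ident z) = label_of L z"
    and "view_cert (view_of t L ident cert v) (ident z) = cert z"
proof -
  have u: "u = z" if "u \<in> hop_ball L t v" "ident z = ident u" for u
    using assms that hop_ball_nodes[OF assms(2)] by (metis inj_onD subsetD)
  show "view_label (view_of t L ident cert v) (ident z) = label_of L z"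
    unfolding view_label_def view_of_def using assms(3) u
    by (intro some_equality) auto
  show "view_cert (view_of t L ident cert v) (ident z) = cert z"
    unfolding view_cert_def view_of_def using assms(3) u
    by (intro some_equality) auto
qed

lemma view_edges_subset: "view_edges (view_of t L ident cert v) \<subseteq> id_arcs L ident"
  unfolding view_of_def id_arcs_def by auto

lemma view_edges_ball:
  assumes "(x, y) \<in> parcs (graph_of L)" "x \<in> hop_ball L t v" "y \<in> hop_ball L t v"
  shows "(ident x, ident y, weight_of L (x, y)) \<in> view_edges (view_of t L ident cert v)"
  unfolding view_of_def using assms by (auto intro!: image_eqI[of _ _ "(x, y)"])

text \<open>The induction carries the number \<open>j\<close> of hops already used, so that
  \<open>j + k \<le> t\<close> keeps the rest of the walk inside the ball.\<close>

lemma walk_in_view: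
  assumes wf: "pair_wf_digraph (graph_of L)" and inj: "inj_on ident (nodes L)"
  shows "walk (id_arcs L ident) x k W z \<Longrightarrow> x = ident u \<Longrightarrow> u \<in> hop_ball L j v \<Longrightarrow> j + k \<le> t \<Longrightarrow>
    walk (view_edges (view_of t L ident cert v)) x k W z \<and> z \<in> ident ` hop_ball L t v"
proof (induction arbitrary: u j rule: walk.induct)
  case (walk_refl x)
  then have "u \<in> hop_ball L t v" using hop_ball_mono[of j t] by auto
  then show ?case using walk_refl walk.walk_refl by auto
next
  case (walk_step x y c k W z)
  from walk_step obtain x' y' where a: "x = ident x'" "y = ident y'" "c = weight_of L (x', y')"
    "(x', y') \<in> parcs (graph_of L)" by (auto simp: id_arcs_def)
  have N: "x' \<in> nodes L" "u \<in> nodes L"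
    using pair_wf_digraph.in_arcsD1[OF wf a(4)] hop_ball_nodes[OF wf] walk_step.prems by auto
  have u: "x' = u" using inj a(1) walk_step.prems N by (auto dest: inj_onD)
  have y: "y' \<in> hop_ball L (Suc j) v" using hop_ball_step[OF wf] a(4) u walk_step.prems by blast
  have "x' \<in> hop_ball L t v" "y' \<in> hop_ball L t v"
    using u y walk_step.prems hop_ball_mono[of j t L v] hop_ball_mono[of "Suc j" t L v] by auto
  then have "(x, y, c) \<in> view_edges (view_of t L ident cert v)"
    using view_edges_ball a by blast
  moreover have "walk (view_edges (view_of t L ident cert v)) y k W z \<and> z \<in> ident ` hop_ball L t v"
    using walk_step.IH[OF a(2) y] walk_step.prems by simp
  ultimately show ?case using walk.walk_step by metis
qed

lemma known_cong:
  assumes "\<And>k W z. k \<le> s \<Longrightarrow> walk E v k W z \<longleftrightarrow> walk E' v k W z"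
    and "\<And>k W z. k \<le> s \<Longrightarrow> walk E v k W z \<Longrightarrow> D z = D' z"
  shows "known E D s v = known E' D' s v"
proof (intro set_eqI)
  fix p
  show "p \<in> known E D s v \<longleftrightarrow> p \<in> known E' D' s v"
    unfolding known_def using assms by (cases p) (simp, metis)
qed

text \<open>The check is local: it reads the arcs leaving \<open>v\<close> and the claims, labels
  and roots of \<open>v\<close> and its neighbours.\<close>

lemma diam_check_cong:
  assumes arcs: "\<And>w c. (v, w, c) \<in> E \<longleftrightarrow> (v, w, c) \<in> E'"
    and kn: "\<And>w. w = v \<or> (\<exists>c. (v, w, c) \<in> E) \<Longrightarrow> known E D s w = known E' D' s w"
    and lb: "\<And>w. w = v \<or> (\<exists>c. (v, w, c) \<in> E) \<Longrightarrow> lab w = lab' w \<and> r w = r' w"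
  shows "diam_check_at E D lab r s v \<longleftrightarrow> diam_check_at E' D' lab' r' s v"
proof -
  have kv: "known E D s v = known E' D' s v" using kn by blast
  have lv: "lab v = lab' v" "r v = r' v" using lb by blast+
  have t: "targets E D s v = targets E' D' s v" "est E D s v = est E' D' s v"
    unfolding targets_def est_def kv by auto
  have tn: "targets E D s w = targets E' D' s w" "est E D s w = est E' D' s w" if "(v, w, c) \<in> E" for w c
  proof -
    have "known E D s w = known E' D' s w" using kn that by blast
    then show "targets E D s w = targets E' D' s w" "est E D s w = est E' D' s w"
      unfolding targets_def est_def by auto
  qed
  have ln: "lab w = lab' w" "r w = r' w" if "(v, w, c) \<in> E" for w c
    using lb that by blast+
  have "bellman_at E D s v \<longleftrightarrow> bellman_at E' D' s v"
    unfolding bellman_at_def t using tn arcs by (smt (verit, best))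
  then show ?thesis unfolding diam_check_at_def t lv using ln arcs by (smt (verit, best))
qed

definition view_check :: "(bool list \<Rightarrow> (nat \<times> nat) set) \<Rightarrow> (bool list \<Rightarrow> nat) \<Rightarrow> nat \<Rightarrow> view \<Rightarrow> bool" where
  "view_check tab rt s V \<longleftrightarrow>
     diam_check_at (view_edges V) (\<lambda>z. tab (view_cert V z)) (\<lambda>z. label_val (view_label V z))
       (\<lambda>z. rt (view_cert V z)) s (center V)"

text \<open>The radius is \<open>Suc s\<close> because a node recomputes the estimates of its
  neighbours: one hop reaches a neighbour, and \<open>s\<close> more explore what that neighbour can
  derive.\<close>

lemma view_check_iff:
  assumes wf: "pair_wf_digraph (graph_of L)" and inj: "inj_on ident (nodes L)" and v: "v \<in> nodes L"
  defines "nd \<equiv> inv_into (nodes L) ident"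
  shows "view_check tab rt s (view_of (Suc s) L ident cert v) \<longleftrightarrow>
     diam_check_at (id_arcs L ident) (\<lambda>z. tab (cert (nd z))) (\<lambda>z. label_val (label_of L (nd z)))
       (\<lambda>z. rt (cert (nd z))) s (ident v)"
proof -
  let ?V = "view_of (Suc s) L ident cert v"
  have nd: "nd (ident x) = x" if "x \<in> nodes L" for x
    unfolding nd_def using inj that by simp
  have c: "center ?V = ident v" unfolding view_of_def by simp
  have v0: "v \<in> hop_ball L 0 v" using v hop_ball_self by simp
  have nbr: "\<exists>x. w = ident x \<and> x \<in> hop_ball L 1 v \<and> (\<forall>c. (ident v, w, c) \<in> id_arcs L ident \<longrightarrow> (ident v, w, c) \<in> view_edges ?V)"
    if w: "w = ident v \<or> (\<exists>c. (ident v, w, c) \<in> id_arcs L ident)" for w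
  proof -
    have *: "\<exists>y. w = ident y \<and> c = weight_of L (v, y) \<and> (v, y) \<in> parcs (graph_of L)" if "(ident v, w, c) \<in> id_arcs L ident" for c
      using that inj v pair_wf_digraph.in_arcsD1[OF wf] unfolding id_arcs_def by (auto dest: inj_onD)
    have y1: "y \<in> hop_ball L 1 v" if "(v, y) \<in> parcs (graph_of L)" for y
      using hop_ball_step[OF wf v0 that] by simp
    have "(ident v, w, c) \<in> view_edges ?V" if "(ident v, w, c) \<in> id_arcs L ident" for c
    proof -
      from *[OF that] obtain y where y: "w = ident y" "c = weight_of L (v, y)" "(v, y) \<in> parcs (graph_of L)" by blast
      have "y \<in> hop_ball L (Suc s) v" using y1[OF y(3)] hop_ball_mono[of 1 "Suc s"] by auto
      then show ?thesis using view_edges_ball[OF y(3)] hop_ball_self v y by blast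
    qed
    moreover have "\<exists>x. w = ident x \<and> x \<in> hop_ball L 1 v"
      using w * y1 hop_ball_self[OF v] by metis
    ultimately show ?thesis by blast
  qed
  show ?thesis
    unfolding view_check_def c
  proof (rule diam_check_cong)
    fix w c
    show "(ident v, w, c) \<in> view_edges ?V \<longleftrightarrow> (ident v, w, c) \<in> id_arcs L ident"
    proof
      assume e: "(ident v, w, c) \<in> id_arcs L ident"
      then have "w = ident v \<or> (\<exists>c. (ident v, w, c) \<in> id_arcs L ident)" by blast
      from nbr[OF this] e show "(ident v, w, c) \<in> view_edges ?V" by blast
    qed (rule subsetD[OF view_edges_subset])
  next
    fix w assume "w = ident v \<or> (\<exists>c. (ident v, w, c) \<in> view_edges ?V)"
    then have "w = ident v \<or> (\<exists>c. (ident v, w, c) \<in> id_arcs L ident)"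
      using subsetD[OF view_edges_subset] by metis
    from nbr[OF this] obtain x where x: "w = ident x" "x \<in> hop_ball L 1 v" by metis
    note wv = walk_in_view[OF wf inj _ x, where t = "Suc s" and cert = cert]
    have iff: "walk (view_edges ?V) w k W z \<longleftrightarrow> walk (id_arcs L ident) w k W z" if "k \<le> s" for k W z
      using wv[of k W z] that walk_mono[OF _ view_edges_subset] by auto
    show "known (view_edges ?V) (\<lambda>z. tab (view_cert ?V z)) s w = known (id_arcs L ident) (\<lambda>z. tab (cert (nd z))) s w"
    proof (rule known_cong)
      fix k W z assume k: "k \<le> s" and "walk (view_edges ?V) w k W z"
      then have "z \<in> ident ` hop_ball L (Suc s) v" using wv[of k W z] iff[OF k] by simp
      then obtain y where y: "z = ident y" "y \<in> hop_ball L (Suc s) v" by blast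
      have "y \<in> nodes L" using y hop_ball_nodes[OF wf] by auto
      then show "tab (view_cert ?V z) = tab (cert (nd z))"
        using y view_label_cert(2)[OF inj wf y(2)] nd by simp
    qed (use iff in auto)
    have "x \<in> hop_ball L (Suc s) v" using x(2) hop_ball_mono[of 1 "Suc s"] by auto
    moreover from this have "x \<in> nodes L" using hop_ball_nodes[OF wf] by auto
    ultimately show "label_val (view_label ?V w) = label_val (label_of L (nd w)) \<and>
        rt (view_cert ?V w) = rt (cert (nd w))"
      using view_label_cert[OF inj wf, of x] x(1) nd by simp
  qed
qed

section \<open>Prefix-free encoding of certificates\<close>

section \<open>The upper bound\<close>

text \<open>Each binary digit follows a continuation flag \<open>True\<close>, and
  \<open>False\<close> ends the number. The code is therefore self-delimiting, at two bits per
  digit.\<close>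

fun bits_of :: "nat \<Rightarrow> bool list" where
  "bits_of n = (if n = 0 then [False] else True # odd n # bits_of (n div 2))"

declare bits_of.simps [simp del]

lemma bits_of_prefix_free: "bits_of m @ xs = bits_of n @ ys \<Longrightarrow> m = n \<and> xs = ys"
proof (induction m arbitrary: n rule: bits_of.induct)
  case (1 m)
  show ?case
  proof (cases "m = 0 \<or> n = 0")
    case True
    then show ?thesis using 1(2) by (auto simp: bits_of.simps[of m] bits_of.simps[of n] split: if_splits)
  next
    case False
    then have "odd m = odd n" "bits_of (m div 2) @ xs = bits_of (n div 2) @ ys"
      using 1(2) by (auto simp: bits_of.simps[of m] bits_of.simps[of n])
    moreover from this have "m div 2 = n div 2 \<and> xs = ys" using 1(1) False by blast
    ultimately show ?thesis by (metis dvd_div_mult_self odd_two_times_div_two_succ)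
  qed
qed

lemma length_bits_of: "1 \<le> n \<Longrightarrow> real (length (bits_of n)) \<le> 2 * log 2 (real n) + 3"
proof (induction n rule: bits_of.induct)
  case (1 n)
  show ?case
  proof (cases "n = 1")
    case True
    then show ?thesis by (simp add: bits_of.simps)
  next
    case False
    then have n: "n \<ge> 2" using 1 by simp
    then have "1 \<le> n div 2" by linarith
    then have "real (length (bits_of (n div 2))) \<le> 2 * log 2 (real (n div 2)) + 3"
      using 1(1) n by simp
    then have "real (length (bits_of n)) \<le> 2 + (2 * log 2 (real (n div 2)) + 3)"
      using n by (simp add: bits_of.simps[of n])
    also have "log 2 (real (n div 2)) \<le> log 2 (real n / 2)"
      using n by (intro log_mono) (auto simp: real_of_nat_div)
    also have "log 2 (real n / 2) = log 2 (real n) - 1" using n by (simp add: log_divide)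
    finally show ?thesis by simp
  qed
qed

definition encode :: "nat list \<Rightarrow> bool list" where
  "encode xs = concat (map bits_of xs)"

lemma bits_of_nonempty: "bits_of n \<noteq> []"
  by (simp add: bits_of.simps)

lemma inj_encode: "inj encode"
proof (rule injI)
  fix xs ys show "encode xs = encode ys \<Longrightarrow> xs = ys"
  proof (induction xs arbitrary: ys)
    case Nil
    then show ?case by (cases ys) (auto simp: encode_def bits_of_nonempty)
  next
    case (Cons x xs)
    then obtain y ys' where ys: "ys = y # ys'"
      by (cases ys) (auto simp: encode_def bits_of_nonempty)
    then have "x = y \<and> encode xs = encode ys'"
      using Cons.prems bits_of_prefix_free[of x "encode xs" y "encode ys'"] by (simp add: encode_def)
    then show ?case using Cons.IH ys by simp
  qed
qed

lemma length_encode: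
  assumes "\<And>x. x \<in> set xs \<Longrightarrow> real (length (bits_of x)) \<le> M"
  shows "real (length (encode xs)) \<le> real (length xs) * M"
  using assms by (induction xs) (auto simp: encode_def algebra_simps intro!: add_mono)

text \<open>On strings that encode no list the value is unspecified. This is harmless, as the
  soundness of the check holds for arbitrary tables and roots.\<close>

definition decode :: "bool list \<Rightarrow> nat list" where
  "decode = inv encode"

lemma decode_encode [simp]: "decode (encode xs) = xs"
  unfolding decode_def using inj_encode by simp

definition cert_root :: "bool list \<Rightarrow> nat" where
  "cert_root c = hd (decode c)"

definition cert_table :: "bool list \<Rightarrow> (nat \<times> nat) set" where
  "cert_table c = {p. prod_encode p \<in> set (tl (decode c))}"

definition mk_cert :: "nat \<Rightarrow> (nat \<times> nat) set \<Rightarrow> bool list" where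
  "mk_cert r T = encode (r # sorted_list_of_set (prod_encode ` T))"

lemma cert_root_mk [simp]: "cert_root (mk_cert r T) = r"
  unfolding cert_root_def mk_cert_def by simp

lemma cert_table_mk [simp]: "finite T \<Longrightarrow> cert_table (mk_cert r T) = T"
  unfolding cert_table_def mk_cert_def by (auto dest: injD[OF inj_prod_encode])

lemma length_mk_cert:
  assumes "finite T" "real (length (bits_of r)) \<le> M"
    "\<And>p. p \<in> T \<Longrightarrow> real (length (bits_of (prod_encode p))) \<le> M"
  shows "real (length (mk_cert r T)) \<le> (1 + real (card T)) * M"
proof -
  have "length (sorted_list_of_set (prod_encode ` T)) = card T"
    by (simp add: card_image inj_prod_encode)
  moreover have "real (length (encode (r # sorted_list_of_set (prod_encode ` T))))
      \<le> real (length (r # sorted_list_of_set (prod_encode ` T))) * M"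
    by (rule length_encode) (use assms in auto)
  ultimately show ?thesis unfolding mk_cert_def by simp
qed

section \<open>Offsets that balance the number of stored distances\<close>

text \<open>
  Averaged over the \<open>t\<close> values of \<open>i x\<close>, adding \<open>x\<close> to \<open>U\<close> multiplies the sum by \<open>1 + 1 / t\<close>.
\<close>

lemma balanced_choice:
  fixes g :: "'b \<Rightarrow> 'a \<Rightarrow> nat"
  assumes "finite U" "finite A" "t \<ge> 1" and g: "\<And>u v. g u v < t"
  shows "\<exists>i. (\<forall>u. i u < t) \<and>
    (\<Sum>v\<in>A. 2 ^ card {u \<in> U. g u v = i u}) \<le> real (card A) * (1 + 1 / real t) ^ card U"
  using assms(1)
proof (induction U)
  case empty
  then show ?case using \<open>t \<ge> 1\<close> by (intro exI[of _ "\<lambda>_. 0"]) auto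
next
  case (insert x U)
  then obtain i where i: "\<forall>u. i u < t"
    "(\<Sum>v\<in>A. 2 ^ card {u \<in> U. g u v = i u}) \<le> real (card A) * (1 + 1 / real t) ^ card U" by blast
  define l where "l v = card {u \<in> U. g u v = i u}" for v
  \<comment> \<open>\<open>F j\<close> is the potential after giving \<open>x\<close> the offset
    \<open>j\<close>: the term of \<open>v\<close> doubles exactly when
    \<open>g x v = j\<close>.\<close>
  define F where "F j = (\<Sum>v\<in>A. 2 ^ l v * (1 + of_bool (g x v = j)) :: real)" for j
  define S where "S = (\<Sum>v\<in>A. 2 ^ l v :: real)"
  have F: "(\<Sum>v\<in>A. 2 ^ card {u \<in> insert x U. g u v = (i(x := j)) u}) = F j" for j
    unfolding F_def
  proof (rule sum.cong[OF refl])
    fix v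
    have "{u \<in> insert x U. g u v = (i(x := j)) u} =
      (if g x v = j then insert x {u \<in> U. g u v = i u} else {u \<in> U. g u v = i u})"
      using insert.hyps by auto
    then have "card {u \<in> insert x U. g u v = (i(x := j)) u} = l v + of_bool (g x v = j)"
      using insert.hyps unfolding l_def by auto
    then show "2 ^ card {u \<in> insert x U. g u v = (i(x := j)) u} = (2::real) ^ l v * (1 + of_bool (g x v = j))"
      by (simp add: power_add)
  qed
  have "(\<Sum>j<t. F j) = (\<Sum>v\<in>A. \<Sum>j<t. 2 ^ l v * (1 + of_bool (g x v = j)))"
    unfolding F_def by (rule sum.swap)
  also have "\<dots> = (\<Sum>v\<in>A. 2 ^ l v * (real t + 1))"
  proof (rule sum.cong[OF refl])
    fix v
    have "(\<Sum>j<t. of_bool (g x v = j) :: real) = 1"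
      using g[of x v] by (simp add: of_bool_def sum.delta)
    then show "(\<Sum>j<t. (2::real) ^ l v * (1 + of_bool (g x v = j))) = 2 ^ l v * (real t + 1)"
      by (simp add: sum_distrib_left[symmetric] sum.distrib)
  qed
  also have "\<dots> = (real t + 1) * S" unfolding S_def by (simp add: sum_distrib_left mult.commute)
  finally have tot: "(\<Sum>j<t. F j) = (real t + 1) * S" .
  \<comment> \<open>Each \<open>v\<close> is hit by one of the \<open>t\<close> offsets, so
    \<open>F\<close> averages to \<open>(1 + 1 / t) * S\<close>; some offset is at most
    average.\<close>
  have "\<exists>j<t. F j \<le> (1 + 1 / real t) * S"
  proof (rule ccontr)
    assume "\<not> ?thesis"
    then have "(\<Sum>j<t. (1 + 1 / real t) * S) < (\<Sum>j<t. F j)"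
      using \<open>t \<ge> 1\<close> by (intro sum_strict_mono) (auto simp: not_le lessThan_empty_iff)
    then show False using tot \<open>t \<ge> 1\<close> by (simp add: field_simps)
  qed
  then obtain j where j: "j < t" "F j \<le> (1 + 1 / real t) * S" by blast
  note j(2)
  also have "\<dots> \<le> (1 + 1 / real t) * (real (card A) * (1 + 1 / real t) ^ card U)"
    using i(2) unfolding S_def l_def by (intro mult_left_mono) auto
  also have "\<dots> = real (card A) * (1 + 1 / real t) ^ card (insert x U)"
    using insert.hyps by simp
  finally show ?case using F[of j] i(1) j(1) by (intro exI[of _ "i(x := j)"]) auto
qed

text \<open>A single term is at most the whole potential, which is at most
  \<open>n * exp (n / t)\<close>. The binary logarithm turns this into a bound on each load.\<close>

lemma balanced_load:
  fixes g :: "'a \<Rightarrow> 'a \<Rightarrow> nat"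
  assumes A: "finite A" "A \<noteq> {}" and t: "t \<ge> 1" and g: "\<And>u v. g u v < t"
  shows "\<exists>i. (\<forall>u. i u < t) \<and> (\<forall>v \<in> A. real (card {u \<in> A. g u v = i u})
    \<le> log 2 (real (card A)) + 2 * (real (card A) / real t))"
proof -
  define n where "n = card A"
  have n: "n \<ge> 1" using A unfolding n_def by (simp add: Suc_le_eq card_gt_0_iff)
  obtain i where i: "\<forall>u. i u < t"
    "(\<Sum>v\<in>A. 2 ^ card {u \<in> A. g u v = i u}) \<le> real n * (1 + 1 / real t) ^ n"
    using balanced_choice[of A A t g] A t g unfolding n_def by blast
  have "real (card {u \<in> A. g u v = i u}) \<le> log 2 (real n) + 2 * (real n / real t)" if v: "v \<in> A" for v
  proof -
    let ?l = "card {u \<in> A. g u v = i u}"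
    have "(2::real) ^ ?l \<le> (\<Sum>v\<in>A. 2 ^ card {u \<in> A. g u v = i u})"
      using A v by (intro member_le_sum) auto
    also have "\<dots> \<le> real n * (1 + 1 / real t) ^ n" using i by simp
    also have "\<dots> \<le> real n * exp (1 / real t) ^ n"
      by (intro mult_left_mono power_mono exp_ge_add_one_self) auto
    also have "\<dots> = real n * exp (real n / real t)"
      by (simp add: exp_of_nat_mult[symmetric])
    finally have "log 2 (2 ^ ?l) \<le> log 2 (real n * exp (real n / real t))"
      using n by (subst log_le_cancel_iff) auto
    moreover have "log 2 (real n * exp (real n / real t)) = log 2 (real n) + log 2 (exp (real n / real t))"
      using n by (simp add: log_mult)
    moreover have "log 2 (exp (real n / real t)) = real n / real t / ln 2" by (simp add: log_def)
    moreover have "log 2 (2 ^ ?l) = real ?l" by simp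
    ultimately have "real ?l \<le> log 2 (real n) + real n / real t / ln 2" by linarith
    also have "real n / real t / ln 2 \<le> 2 * (real n / real t)"
    proof -
      \<comment> \<open>The bound \<open>ln x \<le> x - 1\<close> at 1/2 yields
        \<open>ln 2 \<ge> 1 / 2\<close>.\<close>
      have "1 / ln 2 \<le> (2::real)"
        using ln_le_minus_one[of "1 / 2 :: real"] by (simp add: field_simps ln_div)
      then have "(real n / real t) * (1 / ln 2) \<le> (real n / real t) * 2" by (intro mult_left_mono) auto
      then show ?thesis by (simp add: mult.commute)
    qed
    finally show ?thesis by simp
  qed
  then show ?thesis using i(1) unfolding n_def by blast
qed

section \<open>Distance tables and the scheme\<close>

context wgraph
begin

lemma hops_below:
  assumes "v \<in> N" "u \<in> N"
  shows "j \<le> hops v u \<Longrightarrow> \<exists>z \<in> N. hops z u = j"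
proof (induction "hops v u - j" arbitrary: j)
  case 0
  then show ?case using assms by auto
next
  case (Suc d)
  then have "d = hops v u - Suc j" "Suc j \<le> hops v u" by auto
  from Suc(1)[OF this] obtain z where z: "z \<in> N" "hops z u = Suc j" by blast
  have "hops u u = 0" using hops_le[of u 0 u] walk_refl[of E u] by (simp add: dist_self)
  then have "u \<noteq> z" using z by auto
  then obtain w c where "(z, w, c) \<in> E" "hops z u = Suc (hops w u)"
    using next_hop[OF z(1) assms(2)] by blast
  then show ?case using z E_wf by auto
qed

text \<open>Every value from 0 to \<open>hops v u\<close> is the hop count of some node, so there
  are more nodes than hops.\<close>

lemma hops_less_card:
  assumes "v \<in> N" "u \<in> N"
  shows "hops v u < card N"
proof -
  have "{..hops v u} \<subseteq> (\<lambda>z. hops z u) ` N" using hops_below[OF assms] by force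
  then have "card {..hops v u} \<le> card N" using finite_N by (rule surj_card_le[rotated])
  then show ?thesis by simp
qed

lemma dist_le_hops:
  assumes c: "\<And>x y c. (x, y, c) \<in> E \<Longrightarrow> real c \<le> M" and u: "u \<in> N" and v: "v \<in> N"
  shows "real (dst v u) \<le> real (hops v u) * M"
proof -
  have "walk E x k W y \<Longrightarrow> real W \<le> real k * M" for x k W y
    by (induction rule: walk.induct) (auto simp: algebra_simps dest: c)
  then show ?thesis using walk_hops[OF v u] by blast
qed

text \<open>The offset depends on the target alone, so that residues along a path to it are compared
  with a fixed value. Only the prover computes it: the verifier takes the least derivable
  claim.\<close>

definition balanced_offset :: "nat \<Rightarrow> 'a \<Rightarrow> nat" where
  "balanced_offset t = (SOME i. (\<forall>u. i u < t) \<and> (\<forall>v \<in> N. real (card {u \<in> N. hops v u mod t = i u})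
    \<le> log 2 (real (card N)) + 2 * (real (card N) / real t)))"

lemma balanced_offset:
  assumes "t \<ge> 1"
  shows "balanced_offset t u < t"
    and "v \<in> N \<Longrightarrow> real (card {u \<in> N. hops v u mod t = balanced_offset t u})
      \<le> log 2 (real (card N)) + 2 * (real (card N) / real t)"
proof -
  have "\<exists>i. (\<forall>u. i u < t) \<and> (\<forall>v \<in> N. real (card {u \<in> N. hops v u mod t = i u})
    \<le> log 2 (real (card N)) + 2 * (real (card N) / real t))"
    using balanced_load[OF finite_N N_nonempty assms, of "\<lambda>u v. hops v u mod t"] assms by simp
  from someI_ex[OF this] show "balanced_offset t u < t"
    "v \<in> N \<Longrightarrow> real (card {u \<in> N. hops v u mod t = balanced_offset t u})
      \<le> log 2 (real (card N)) + 2 * (real (card N) / real t)"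
    unfolding balanced_offset_def by blast+
qed

definition dist_table :: "nat \<Rightarrow> 'a \<Rightarrow> ('a \<times> nat) set" where
  "dist_table t v = {(u, dst v u) | u. u \<in> N \<and> hops v u mod t = balanced_offset t u}"

lemma dist_table_image:
  "dist_table t v = (\<lambda>u. (u, dst v u)) ` {u \<in> N. hops v u mod t = balanced_offset t u}"
  unfolding dist_table_def by auto

lemma finite_dist_table: "finite (dist_table t v)"
  unfolding dist_table_image using finite_N by simp

lemma card_dist_table:
  assumes "t \<ge> 1" "v \<in> N"
  shows "real (card (dist_table t v)) \<le> log 2 (real (card N)) + 2 * (real (card N) / real t)"
  unfolding dist_table_image
  using balanced_offset(2)[OF assms] by (subst card_image) (auto simp: inj_on_def)

definition diam_source :: 'a where
  "diam_source = (SOME x. x \<in> N \<and> (\<exists>y \<in> N. dst x y = diam))"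

lemma diam_source: "diam_source \<in> N" "\<exists>y \<in> N. dst diam_source y = diam"
proof -
  have "\<exists>x. x \<in> N \<and> (\<exists>y \<in> N. dst x y = diam)" using diam_attained by blast
  from someI_ex[OF this] show "diam_source \<in> N" "\<exists>y \<in> N. dst diam_source y = diam"
    unfolding diam_source_def by blast+
qed

end

text \<open>The certificate names an end of a diametral pair, followed by the distance table. The
  verifier explores only \<open>t - 1\<close> hops from each node, the remaining hop being the one
  to a neighbour.\<close>

definition diam_scheme :: "nat \<Rightarrow> scheme" where
  "diam_scheme t = \<lparr> radius = t,
     prover = (\<lambda>L ident v. mk_cert (wgraph.diam_source (ident ` nodes L) (id_arcs L ident))
       (wgraph.dist_table (ident ` nodes L) (id_arcs L ident) t (ident v))),
     verifier = view_check cert_table cert_root (t - 1) \<rparr>"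

lemma diam_scheme_is_pls:
  assumes "t \<ge> 1"
  shows "is_pls a b DIAM (diam_scheme t)"
  unfolding is_pls_def
proof (intro allI impI conjI ballI)
  fix L ident assume inst: "instance_of a b L ident"
  then have V: "valid_lgraph b L" and inj: "inj_on ident (nodes L)"
    unfolding instance_of_def valid_ids_def by auto
  have wf: "pair_wf_digraph (graph_of L)"
    using V unfolding valid_lgraph_def pair_graph_def pair_digraph_def pair_fin_digraph_def by blast
  interpret W: wgraph "ident ` nodes L" "id_arcs L ident" using wgraph_id_arcs[OF V inj] .
  define nd where "nd = inv_into (nodes L) ident"
  have nd: "nd (ident x) = x" if "x \<in> nodes L" for x
    unfolding nd_def using inj that by simp
  have acc: "accepts_at (diam_scheme t) L ident cert v \<longleftrightarrow>
     diam_check_at (id_arcs L ident) (\<lambda>z. cert_table (cert (nd z))) (\<lambda>z. label_val (label_of L (nd z)))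
       (\<lambda>z. cert_root (cert (nd z))) (t - 1) (ident v)" if "v \<in> nodes L" for cert v
    using view_check_iff[OF wf inj that, where s = "t - 1"] assms
    unfolding accepts_at_def diam_scheme_def nd_def by simp
  { fix v assume D: "DIAM L" and v: "v \<in> nodes L"
    show "accepts_at (diam_scheme t) L ident (prover (diam_scheme t) L ident) v"
      unfolding acc[OF v]
    proof (rule W.diam_check_complete[where i = "W.balanced_offset t" and ?r0.0 = W.diam_source])
      fix z assume "z \<in> ident ` nodes L"
      then obtain x where x: "x \<in> nodes L" "z = ident x" by auto
      show "cert_table (prover (diam_scheme t) L ident (nd z)) =
        {(u, W.dst z u) |u. u \<in> ident ` nodes L \<and> W.hops z u mod Suc (t - 1) = W.balanced_offset t u}"
        using x nd assms W.finite_dist_table unfolding diam_scheme_def by (simp add: W.dist_table_def)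
      show "cert_root (prover (diam_scheme t) L ident (nd z)) = W.diam_source"
        unfolding diam_scheme_def by simp
      show "label_val (label_of L (nd z)) = W.diam"
        using D x nd DIAM_iff[OF V inj] by simp
    next
      fix u show "W.balanced_offset t u \<le> t - 1"
        using W.balanced_offset(1)[OF assms, of u] by simp
    qed (use W.diam_source v in auto) }
  { fix cert assume D: "\<not> DIAM L"
    show "\<exists>v \<in> nodes L. \<not> accepts_at (diam_scheme t) L ident cert v"
    proof (rule ccontr)
      assume "\<not> ?thesis"
      then have all: "diam_check_at (id_arcs L ident) (\<lambda>z. cert_table (cert (nd z)))
          (\<lambda>z. label_val (label_of L (nd z))) (\<lambda>z. cert_root (cert (nd z))) (t - 1) z"
        if "z \<in> ident ` nodes L" for z
        using acc that by auto
      have "label_val (label_of L v) = W.diam" if "v \<in> nodes L" for v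
        using W.diam_check_sound[OF all, of "ident v"] that nd by simp
      then show False using D DIAM_iff[OF V inj] by simp
    qed }
qed

text \<open>Pairing is quadratic, so a coded pair costs only a constant factor more bits than its
  components.\<close>

lemma prod_encode_le: "prod_encode (u, d) \<le> (u + d + 1)\<^sup>2"
proof -
  have "triangle k \<le> k * (k + 1)" for k
    unfolding triangle_def by simp
  then have "prod_encode (u, d) \<le> (u + d) * (u + d + 1) + u"
    unfolding prod_encode_def by simp
  also have "\<dots> \<le> (u + d + 1)\<^sup>2" by (simp add: power2_eq_square)
  finally show ?thesis .
qed

lemma length_bits_of_le:
  assumes "real x \<le> Y" "1 \<le> Y"
  shows "real (length (bits_of x)) \<le> 2 * log 2 Y + 3"
proof (cases "x = 0")
  case True
  then show ?thesis using assms by (simp add: bits_of.simps)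
next
  case False
  then have "log 2 (real x) \<le> log 2 Y" using assms by (intro log_mono) auto
  then show ?thesis using length_bits_of[of x] False by simp
qed

text \<open>Identities are at most \<open>n powr a\<close>; distances are at most
  \<open>n powr (b + 1)\<close>, as shortest paths have fewer than \<open>n\<close> hops. Every
  entry thus takes a number of bits linear in \<open>log 2 n\<close>, and there are at most
  \<open>log 2 n + 2 * n / t\<close> entries.\<close>

lemma diam_scheme_cert_length:
  assumes ab: "a \<ge> 1" "b \<ge> 1" and inst: "instance_of a b L ident" and n: "num_nodes L = n" "n \<ge> 2"
    and t: "t \<ge> 1" "real t \<le> real n / log 2 (real n)" and v: "v \<in> nodes L"
  shows "real (length (prover (diam_scheme t) L ident v))
    \<le> 4 * (4 * (a + b + 3) + 3) * (real n / real t * (log 2 (real n))\<^sup>2)"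
proof -
  have V: "valid_lgraph b L" and inj: "inj_on ident (nodes L)"
    using inst unfolding instance_of_def valid_ids_def by auto
  interpret W: wgraph "ident ` nodes L" "id_arcs L ident" using wgraph_id_arcs[OF V inj] .
  let ?N = "ident ` nodes L"
  define l where "l = log 2 (real n)"
  have l: "l \<ge> 1" unfolding l_def using n by simp
  have cN: "card ?N = n" using n inj by (simp add: num_nodes_def card_image)
  have idb: "real z \<le> real n powr a" if "z \<in> ?N" for z
    using inst that n unfolding instance_of_def valid_ids_def by auto
  have wb: "real c \<le> real n powr b" if "(x, y, c) \<in> id_arcs L ident" for x y c
    using V that n unfolding valid_lgraph_def id_arcs_def by auto
  have db: "real (W.dst x y) \<le> real n * real n powr b" if "x \<in> ?N" "y \<in> ?N" for x y
  proof -
    have "real (W.dst x y) \<le> real (W.hops x y) * real n powr b"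
      by (rule W.dist_le_hops) (use wb that in auto)
    also have "\<dots> \<le> real n * real n powr b"
      using W.hops_less_card[OF that] cN by (intro mult_right_mono) auto
    finally show ?thesis .
  qed
  \<comment> \<open>For \<open>X = n powr (a + b + 1)\<close>, identity, distance and 1 are each at
    most \<open>X\<close>; their sum is at most \<open>4 * X\<close>, and
    \<open>4 \<le> n ^ 2\<close> adds 2 to the exponent. Squaring, for the pairing, doubles
    it.\<close>
  define Y where "Y = real n powr (2 * (a + b + 3))"
  define M where "M = 2 * log 2 Y + 3"
  have Y1: "1 \<le> Y" unfolding Y_def using n ab by (intro ge_one_powr_ge_zero) auto
  have pe: "real (prod_encode (u, d)) \<le> Y" if "real u \<le> real n powr a" "real d \<le> real n * real n powr b" for u d
  proof -
    let ?X = "real n powr (a + b + 1)"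
    have "real n * real n powr b = real n powr (b + 1)" using n by (simp add: powr_add)
    also have "\<dots> \<le> ?X" using n ab by (intro powr_mono) auto
    finally have d: "real d \<le> ?X" using that by linarith
    have "real n powr a \<le> ?X" using n ab by (intro powr_mono) auto
    then have u: "real u \<le> ?X" using that by linarith
    have o: "1 \<le> ?X" using n ab by (intro ge_one_powr_ge_zero) auto
    have "real (u + d + 1) \<le> 4 * ?X" using u d o by simp
    also have "\<dots> \<le> real n ^ 2 * ?X"
      using n power_mono[of 2 "real n" 2] by (intro mult_right_mono) auto
    also have "real n ^ 2 = real n powr 2" using n by simp
    also have "real n powr 2 * ?X = real n powr (2 + (a + b + 1))" by (rule powr_add[symmetric])
    also have "2 + (a + b + 1) = a + b + 3" by simp
    finally have "real (u + d + 1) \<le> real n powr (a + b + 3)" .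
    then have "(real (u + d + 1))\<^sup>2 \<le> (real n powr (a + b + 3))\<^sup>2" by (intro power_mono) auto
    also have "\<dots> = real n powr ((a + b + 3) + (a + b + 3))"
      unfolding power2_eq_square by (rule powr_add[symmetric])
    also have "\<dots> = Y" unfolding Y_def by (simp only: mult_2)
    finally have "real ((u + d + 1)\<^sup>2) \<le> Y" by simp
    moreover have "real (prod_encode (u, d)) \<le> real ((u + d + 1)\<^sup>2)"
      using prod_encode_le by (rule of_nat_mono)
    ultimately show ?thesis by linarith
  qed
  have rb: "real (W.diam_source) \<le> Y"
  proof -
    have "real n powr a \<le> Y" unfolding Y_def using n ab by (intro powr_mono) auto
    then show ?thesis using idb[OF W.diam_source(1)] by simp
  qed
  have "real (length (prover (diam_scheme t) L ident v)) \<le> (1 + real (card (W.dist_table t (ident v)))) * M"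
    unfolding diam_scheme_def
  proof (simp, rule length_mk_cert)
    show "finite (W.dist_table t (ident v))" by (rule W.finite_dist_table)
    show "real (length (bits_of W.diam_source)) \<le> M"
      unfolding M_def using length_bits_of_le[OF rb Y1] .
    fix p assume "p \<in> W.dist_table t (ident v)"
    then obtain u where "p = (u, W.dst (ident v) u)" "u \<in> ?N" unfolding W.dist_table_def by auto
    then have "real (prod_encode p) \<le> Y" using pe idb db v by auto
    then show "real (length (bits_of (prod_encode p))) \<le> M"
      unfolding M_def using length_bits_of_le Y1 by blast
  qed
  also have "\<dots> \<le> (4 * (real n / real t)) * ((4 * (a + b + 3) + 3) * l)"
  proof (rule mult_mono)
    \<comment> \<open>The upper limit on \<open>t\<close> absorbs the summands 1 and
      \<open>log 2 n\<close> of the entry count into \<open>n / t\<close>.\<close>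
    have lt: "l \<le> real n / real t"
      using t l unfolding l_def by (simp add: field_simps)
    show "1 + real (card (W.dist_table t (ident v))) \<le> 4 * (real n / real t)"
      using W.card_dist_table[OF t(1), of "ident v"] v lt l unfolding cN l_def by simp
    have "log 2 Y = 2 * (a + b + 3) * l" unfolding Y_def l_def using n by (simp add: log_powr)
    then show "M \<le> (4 * (a + b + 3) + 3) * l" unfolding M_def using l by (simp add: algebra_simps)
    show "0 \<le> M" unfolding M_def using Y1 by simp
  qed auto
  also have "\<dots> = 4 * (4 * (a + b + 3) + 3) * (real n / real t * l)" by simp
  also have "\<dots> \<le> 4 * (4 * (a + b + 3) + 3) * (real n / real t * l\<^sup>2)"
    using l ab by (intro mult_left_mono) (auto simp: power2_eq_square)
  finally show ?thesis unfolding l_def .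
qed

lemma size_pls_upper:
  assumes ab: "a \<ge> 1" "b \<ge> 1" and n: "n \<ge> 2"
    and t: "t \<ge> 1" "real t \<le> real n / log 2 (real n)"
  shows "ereal_of_enat (size_pls a b DIAM t n)
    \<le> ereal (4 * (4 * (a + b + 3) + 3) * (real n / real t * (log 2 (real n))\<^sup>2))"
proof -
  let ?B = "4 * (4 * (a + b + 3) + 3) * (real n / real t * (log 2 (real n))\<^sup>2)"
  have B: "?B \<ge> 0" using ab by simp
  have "size_pls a b DIAM t n \<le> pls_size a b DIAM (diam_scheme t) n"
    unfolding size_pls_def using diam_scheme_is_pls[OF t(1)]
    by (intro INF_lower) (auto simp: diam_scheme_def)
  also have "\<dots> \<le> enat (nat \<lfloor>?B\<rfloor>)"
    unfolding pls_size_def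
  proof (rule Sup_least)
    fix x assume "x \<in> {enat (length (prover (diam_scheme t) L ident v)) | L ident v.
            instance_of a b L ident \<and> num_nodes L = n \<and> DIAM L \<and> v \<in> nodes L}"
    then obtain L ident v where x: "x = enat (length (prover (diam_scheme t) L ident v))"
      "instance_of a b L ident" "num_nodes L = n" "v \<in> nodes L" by blast
    have "real (length (prover (diam_scheme t) L ident v)) \<le> ?B"
      using diam_scheme_cert_length ab x n t by blast
    then show "x \<le> enat (nat \<lfloor>?B\<rfloor>)" using x(1) by (simp add: le_nat_floor)
  qed
  finally have "ereal_of_enat (size_pls a b DIAM t n) \<le> ereal_of_enat (enat (nat \<lfloor>?B\<rfloor>))"
    by (simp only: ereal_of_enat_le_iff)
  also have "\<dots> \<le> ereal ?B" using B by simp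
  finally show ?thesis .
qed

section \<open>Distances on weighted cycles\<close>

section \<open>The lower bound\<close>

definition cycle_graph :: "nat \<Rightarrow> nat pair_pre_digraph" where
  "cycle_graph n = \<lparr> pverts = {..<n},
     parcs = {(x, y). x < n \<and> y < n \<and> (y = Suc x \<or> x = Suc y \<or> (x = 0 \<and> Suc y = n) \<or> (y = 0 \<and> Suc x = n))} \<rparr>"

definition gap :: "nat \<Rightarrow> nat \<Rightarrow> nat" where
  "gap p q = (p - q) + (q - p)"

text \<open>Node \<open>x\<close> sits at position \<open>p x\<close> on a circle of circumference
  \<open>c\<close>; the closing edge covers the rest of the circle.\<close>

definition cycle_weight :: "nat \<Rightarrow> (nat \<Rightarrow> nat) \<Rightarrow> nat \<times> nat \<Rightarrow> nat" where
  "cycle_weight c p = (\<lambda>(x, y). if y = Suc x \<or> x = Suc y then gap (p x) (p y) else c - gap (p x) (p y))"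

definition cycle_lgraph :: "nat \<Rightarrow> nat \<Rightarrow> (nat \<Rightarrow> nat) \<Rightarrow> bool list \<Rightarrow> lgraph" where
  "cycle_lgraph n c p l = \<lparr> graph_of = cycle_graph n, weight_of = cycle_weight c p, label_of = (\<lambda>_. l) \<rparr>"

lemma cycle_lgraph_simps [simp]:
  "graph_of (cycle_lgraph n c p l) = cycle_graph n"
  "weight_of (cycle_lgraph n c p l) = cycle_weight c p"
  "label_of (cycle_lgraph n c p l) = (\<lambda>_. l)"
  "pverts (cycle_graph n) = {..<n}"
  by (auto simp: cycle_lgraph_def cycle_graph_def)

lemma cycle_weight_commute: "cycle_weight c p (x, y) = cycle_weight c p (y, x)"
  by (auto simp: cycle_weight_def gap_def)

lemma pair_graph_cycle:
  assumes "n \<ge> 3"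
  shows "pair_graph (cycle_graph n)"
proof
  show "finite (pverts (cycle_graph n))" by simp
  have "parcs (cycle_graph n) \<subseteq> {..<n} \<times> {..<n}" by (auto simp: cycle_graph_def)
  then show "finite (parcs (cycle_graph n))" by (rule finite_subset) simp
  show "symmetric (with_proj (cycle_graph n))"
    unfolding symmetric_def sym_def by (auto simp: cycle_graph_def)
qed (use assms in \<open>auto simp: cycle_graph_def\<close>)

lemma connected_cycle:
  assumes "n \<ge> 3"
  shows "connected (with_proj (cycle_graph n))"
proof -
  interpret pair_graph "cycle_graph n" using pair_graph_cycle[OF assms] .
  have 0: "reachable (with_proj (cycle_graph n)) 0 i" if "i < n" for i
    using that
  proof (induction i)
    case 0
    then show ?case using reachable_refl[of 0] by simp
  next
    case (Suc i)
    have "(i, Suc i) \<in> parcs (cycle_graph n)" using Suc.prems by (simp add: cycle_graph_def)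
    then show ?case using Suc reachable_adj_trans[of 0 i "Suc i"] by simp
  qed
  have "reachable (with_proj (cycle_graph n)) u v" if "u < n" "v < n" for u v
    using 0[OF that(1)] 0[OF that(2)] symmetric_reachable[OF sym_arcs] reachable_trans by blast
  then show ?thesis
    unfolding connected_def strongly_connected_def
    using reachable_mk_symmetricI assms by (auto simp: lessThan_empty_iff)
qed

text \<open>The last assumption fits all positions into less than one turn, so that the closing edge
  has positive weight.\<close>

locale weighted_cycle =
  fixes n c :: nat and p :: "nat \<Rightarrow> nat" and l :: "bool list"
  assumes n3: "n \<ge> 3"
    and p_less: "i < j \<Longrightarrow> j < n \<Longrightarrow> p i < p j"
    and p_last: "p (n - 1) < c + p 0"
begin

abbreviation "G \<equiv> cycle_lgraph n c p l"
abbreviation "E \<equiv> id_arcs G (\<lambda>x. x)"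

lemma p_le: "i \<le> j \<Longrightarrow> j < n \<Longrightarrow> p i \<le> p j"
  using p_less[of i j] by (cases "i = j") auto

lemma p_wrap:
  assumes "i \<le> j" "j < n"
  shows "p j - p i < c"
proof -
  have "p 0 \<le> p i" "p i \<le> p j" "p j \<le> p (n - 1)"
    using p_le[of 0 i] p_le[of i j] p_le[of j "n - 1"] assms by auto
  then show ?thesis using p_last by linarith
qed

lemma E_iff: "(x, y, w) \<in> E \<longleftrightarrow> (x, y) \<in> parcs (cycle_graph n) \<and> w = cycle_weight c p (x, y)"
  by (auto simp: id_arcs_def)

lemma weight_pos:
  assumes "(x, y) \<in> parcs (cycle_graph n)"
  shows "1 \<le> cycle_weight c p (x, y)"
proof -
  have "x < n" "y < n" "x \<noteq> y" using assms n3 by (auto simp: cycle_graph_def)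
  then have "gap (p x) (p y) < c" "0 < gap (p x) (p y)"
    using p_wrap[of x y] p_wrap[of y x] p_less[of x y] p_less[of y x]
    by (cases x y rule: linorder_cases; simp add: gap_def)+
  then show ?thesis unfolding cycle_weight_def by auto
qed

lemma walk_up:
  assumes "i \<le> j" "j < n"
  shows "\<exists>k. walk E i k (p j - p i) j" and "\<exists>k. walk E j k (p j - p i) i"
proof -
  have "(\<exists>k. walk E i k (p j - p i) j) \<and> (\<exists>k. walk E j k (p j - p i) i)"
    using assms
  proof (induction j rule: dec_induct)
    case base
    then show ?case using walk_refl[of E i] by auto
  next
    case (step j)
    have e: "(j, Suc j, p (Suc j) - p j) \<in> E" "(Suc j, j, p (Suc j) - p j) \<in> E"
      using step.prems p_less[of j "Suc j"] by (auto simp: E_iff cycle_graph_def cycle_weight_def gap_def)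
    have s: "p (Suc j) - p i = (p j - p i) + (p (Suc j) - p j)"
      using p_le[of i j] p_le[of j "Suc j"] step by simp
    obtain k k' where k: "walk E i k (p j - p i) j" "walk E j k' (p j - p i) i"
      using step by auto
    have "walk E j 1 (p (Suc j) - p j) (Suc j)"
      using walk_step[OF e(1) walk_refl] by simp
    from walk_trans[OF k(1) this] walk_step[OF e(2) k(2)] show ?case
      using s by (metis add.commute)
  qed
  then show "\<exists>k. walk E i k (p j - p i) j" "\<exists>k. walk E j k (p j - p i) i" by auto
qed

lemma walk_around:
  assumes "i \<le> j" "j < n"
  shows "\<exists>k. walk E i k (c - (p j - p i)) j" and "\<exists>k. walk E j k (c - (p j - p i)) i"
proof -
  define w where "w = c - (p (n - 1) - p 0)"
  have e: "(0, n - 1, w) \<in> E" "(n - 1, 0, w) \<in> E"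
    using n3 p_le[of 0 "n - 1"] by (auto simp: E_iff cycle_graph_def cycle_weight_def gap_def w_def)
  have b: "p 0 \<le> p i" "p i \<le> p j" "p j \<le> p (n - 1)"
    using p_le[of 0 i] p_le[of i j] p_le[of j "n - 1"] assms by auto
  have s: "c - (p j - p i) = (p i - p 0) + (w + (p (n - 1) - p j))"
    "c - (p j - p i) = (p (n - 1) - p j) + (w + (p i - p 0))"
  proof -
    from b obtain x y z where e: "p i = p 0 + x" "p j = p i + y" "p (n - 1) = p j + z"
      by (metis le_Suc_ex)
    then have "p j - p i = y" "p i - p 0 = x" "p (n - 1) - p j = z" "w + (x + y + z) = c"
      using p_last unfolding w_def by auto
    then show "c - (p j - p i) = (p i - p 0) + (w + (p (n - 1) - p j))"
      "c - (p j - p i) = (p (n - 1) - p j) + (w + (p i - p 0))" by simp_all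
  qed
  obtain k1 k2 k3 k4 where k: "walk E i k1 (p i - p 0) 0" "walk E (n - 1) k2 (p (n - 1) - p j) j"
    "walk E 0 k3 (p i - p 0) i" "walk E j k4 (p (n - 1) - p j) (n - 1)"
  proof -
    have "0 \<le> i" "i < n" "j \<le> n - 1" "n - 1 < n" using assms by auto
    then show thesis using that walk_up[of 0 i] walk_up[of j "n - 1"] by blast
  qed
  show "\<exists>k. walk E i k (c - (p j - p i)) j"
    using walk_trans[OF k(1) walk_step[OF e(1) k(2)]] s(1) by metis
  show "\<exists>k. walk E j k (c - (p j - p i)) i"
    using walk_trans[OF k(4) walk_step[OF e(2) k(3)]] s(2) by metis
qed

lemma dist_cycle_le:
  assumes "i < n" "j < n"
  shows "dist_in E i j \<le> min (gap (p i) (p j)) (c - gap (p i) (p j))"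
proof (cases "i \<le> j")
  case True
  then have "gap (p i) (p j) = p j - p i" using p_le assms by (simp add: gap_def)
  then show ?thesis using walk_up(1)[OF True assms(2)] walk_around(1)[OF True assms(2)] dist_in_le by fastforce
next
  case False
  then have ji: "j \<le> i" by simp
  then have "gap (p i) (p j) = p i - p j" using p_le assms by (simp add: gap_def)
  then show ?thesis using walk_up(2)[OF ji assms(1)] walk_around(2)[OF ji assms(1)] dist_in_le by fastforce
qed

text \<open>The circular distance to \<open>i\<close> is a potential that changes by at most the
  weight of each arc, so \<open>walk_lipschitz\<close> applies.\<close>

lemma dist_cycle_ge:
  assumes "i < n" "j < n" "walk E j k W i"
  shows "min (gap (p i) (p j)) (c - gap (p i) (p j)) \<le> W"
proof -
  define g where "g x = min (gap (p i) (p x)) (c - gap (p i) (p x))" for x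
  have "g x \<le> w + g y" if "(x, y, w) \<in> E" for x y w
  proof -
    have xy: "(x, y) \<in> parcs (cycle_graph n)" "w = cycle_weight c p (x, y)"
      using that by (auto simp: E_iff)
    show ?thesis
    proof (cases "y = Suc x \<or> x = Suc y")
      case True
      then have "w = gap (p x) (p y)" using xy by (auto simp: cycle_weight_def)
      moreover have "gap (p i) (p x) \<le> gap (p i) (p y) + gap (p x) (p y)"
        "gap (p i) (p y) \<le> gap (p i) (p x) + gap (p x) (p y)"
        unfolding gap_def by linarith+
      ultimately show ?thesis unfolding g_def by linarith
    next
      case False
      then have w: "w = c - gap (p x) (p y)" using xy by (auto simp: cycle_weight_def)
      have xy0: "x = 0 \<and> y = n - 1 \<or> x = n - 1 \<and> y = 0" using xy False by (auto simp: cycle_graph_def)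
      \<comment> \<open>Node \<open>i\<close> splits the stretch from node 0 to node
        \<open>n - 1\<close> into lengths \<open>d\<close> and \<open>e\<close>, and the closing
        edge weighs \<open>c - (d + e)\<close>.\<close>
      define d where "d = p i - p 0"
      define e where "e = p (n - 1) - p i"
      have "p 0 \<le> p i" "p i \<le> p (n - 1)" using p_le[of 0 i] p_le[of i "n - 1"] assms(1) by auto
      then have "gap (p i) (p 0) = d" "gap (p i) (p (n - 1)) = e" and de: "gap (p x) (p y) = d + e" "d + e < c"
        using xy0 p_last unfolding gap_def d_def e_def by auto
      then have "gap (p i) (p x) = d \<and> gap (p i) (p y) = e \<or> gap (p i) (p x) = e \<and> gap (p i) (p y) = d"
        using xy0 by auto
      then show ?thesis
      proof (elim disjE conjE)
        assume "gap (p i) (p x) = d" "gap (p i) (p y) = e"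
        then show ?thesis unfolding g_def w using de by simp
      next
        assume "gap (p i) (p x) = e" "gap (p i) (p y) = d"
        then show ?thesis unfolding g_def w using de by simp
      qed
    qed
  qed
  from walk_lipschitz[of E g, OF this assms(3)] show ?thesis
    unfolding g_def by (simp add: gap_def)
qed

lemma valid_cycle:
  assumes "1 \<le> b" and w: "\<And>x y. (x, y) \<in> parcs (cycle_graph n) \<Longrightarrow> cycle_weight c p (x, y) \<le> n"
  shows "valid_lgraph b G"
proof -
  have "real (cycle_weight c p (x, y)) \<le> real n powr b" if "(x, y) \<in> parcs (cycle_graph n)" for x y
  proof -
    have "real (cycle_weight c p (x, y)) \<le> real n powr 1" using w[OF that] n3 by simp
    also have "\<dots> \<le> real n powr b" using assms(1) n3 by (intro powr_mono) auto
    finally show ?thesis .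
  qed
  then show ?thesis
    unfolding valid_lgraph_def num_nodes_def
    using pair_graph_cycle[OF n3] connected_cycle[OF n3] cycle_weight_commute weight_pos by auto
qed

end

section \<open>Cycles whose diameter tests the equality of two sets\<close>

lemma label_val_surj: "\<exists>l. label_val l = n"
proof (induction n rule: less_induct)
  case (less n)
  show ?case
  proof (cases "n = 0")
    case True
    then show ?thesis by (intro exI[of _ "[]"]) simp
  next
    case False
    then obtain l where "label_val l = n div 2" using less[of "n div 2"] by auto
    then have "label_val (odd n # l) = n" by simp
    then show ?thesis by blast
  qed
qed

definition bin_label :: "nat \<Rightarrow> bool list" where
  "bin_label n = (SOME l. label_val l = n)"

lemma label_val_bin_label: "label_val (bin_label n) = n"
  unfolding bin_label_def using label_val_surj by (rule someI_ex)

text \<open>The summand 2 leaves room for the additional node of the second half when \<open>n\<close> is odd.\<close>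

definition half_turn :: "nat \<Rightarrow> nat" where
  "half_turn n = 2 * (n div 2) + 2"

text \<open>The negated bit in the second half makes nodes \<open>i\<close> and
  \<open>n div 2 + i\<close> antipodal exactly when \<open>i\<close> lies in one of \<open>S\<close>
  and \<open>T\<close> but not in the other; otherwise they miss antipodality by one.\<close>

definition fool_pos :: "nat \<Rightarrow> nat set \<Rightarrow> nat set \<Rightarrow> nat \<Rightarrow> nat" where
  "fool_pos n S T i = (if i < n div 2 then 2 * i + of_bool (i \<in> S)
     else half_turn n + 2 * (i - n div 2) + of_bool (i - n div 2 \<notin> T))"

definition fool_graph :: "nat \<Rightarrow> nat set \<Rightarrow> nat set \<Rightarrow> lgraph" where
  "fool_graph n S T = cycle_lgraph n (2 * half_turn n) (fool_pos n S T) (bin_label (half_turn n - 1))"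

lemma fool_pos_low: "i < n div 2 \<Longrightarrow> fool_pos n S T i = 2 * i + of_bool (i \<in> S)"
  by (simp add: fool_pos_def)

lemma fool_pos_high:
  "n div 2 \<le> i \<Longrightarrow> fool_pos n S T i = 2 * i + 2 + of_bool (i - n div 2 \<notin> T)"
  by (simp add: fool_pos_def half_turn_def)

lemma fool_pos_bounds:
  shows "i < n div 2 \<Longrightarrow> 2 * i \<le> fool_pos n S T i \<and> fool_pos n S T i \<le> 2 * i + 1"
    and "\<not> i < n div 2 \<Longrightarrow> 2 * i + 2 \<le> fool_pos n S T i \<and> fool_pos n S T i \<le> 2 * i + 3"
  by (simp_all add: fool_pos_low fool_pos_high)

lemma fool_pos_less:
  assumes "i < j"
  shows "fool_pos n S T i < fool_pos n S T j"
  using fool_pos_bounds[of i n S T] fool_pos_bounds[of j n S T] assms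
  by (cases "i < n div 2"; cases "j < n div 2"; simp)

text \<open>Nodes of the same half span less than half a turn. Across the halves, only the partners
  \<open>i\<close> and \<open>n div 2 + i\<close> come within the reach of the bits, and agreeing
  sets prevent equality.\<close>

lemma fool_pos_not_antipodal:
  assumes "i \<le> j" "j < n"
    and ne: "\<And>k. k < n div 2 \<Longrightarrow> (k \<in> S) = (k \<in> T)"
  shows "fool_pos n S T j - fool_pos n S T i \<noteq> half_turn n"
proof
  assume eq: "fool_pos n S T j - fool_pos n S T i = half_turn n"
  define m where "m = n div 2"
  have n: "n \<le> 2 * m + 1" unfolding m_def by simp
  have H: "half_turn n = 2 * m + 2" unfolding half_turn_def m_def by simp
  note pb = fool_pos_bounds[of _ n S T, folded m_def]
  have i: "i < m"
  proof (rule ccontr)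
    assume im: "\<not> i < m"
    then have "2 * i + 2 \<le> fool_pos n S T i" "fool_pos n S T j \<le> 2 * j + 3"
      using pb(2)[of i] pb(2)[of j] assms(1) by auto
    then show False using im assms(2) eq n unfolding H by linarith
  qed
  have j: "m \<le> j"
  proof (rule ccontr)
    assume "\<not> m \<le> j"
    then have "fool_pos n S T j \<le> 2 * j + 1" "j < m" using pb(1)[of j] by auto
    then show False using eq unfolding H by linarith
  qed
  have "fool_pos n S T i = 2 * i + of_bool (i \<in> S)"
      "fool_pos n S T j = 2 * j + 2 + of_bool (j - m \<notin> T)"
    using fool_pos_low fool_pos_high i j unfolding m_def by blast+
  then have e: "2 * (j - m) + of_bool (j - m \<notin> T) = 2 * i + (of_bool (i \<in> S) :: nat)"
    using eq j unfolding H by linarith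
  \<comment> \<open>Halving removes the bits, which are 0 or 1; then the bits themselves must be
    equal.\<close>
  then have "j - m = i" by (cases "j - m \<in> T"; cases "i \<in> S"; simp; presburger)
  then show False using e ne[of i] i unfolding m_def by (cases "i \<in> T") auto
qed

lemma weighted_cycle_fool:
  assumes "n \<ge> 5"
  shows "weighted_cycle n (2 * half_turn n) (fool_pos n S T)"
proof
  have "\<not> n - 1 < n div 2" using assms by linarith
  then have "fool_pos n S T (n - 1) \<le> 2 * (n - 1) + 3" using fool_pos_bounds(2) by blast
  moreover have "2 * (n - 1) + 3 < 2 * half_turn n" using assms unfolding half_turn_def by presburger
  ultimately show "fool_pos n S T (n - 1) < 2 * half_turn n + fool_pos n S T 0" by linarith
qed (use assms fool_pos_less in auto)

lemma fool_graph_valid: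
  assumes n: "n \<ge> 5" and "b \<ge> 1"
  shows "valid_lgraph b (fool_graph n S T)"
proof -
  interpret weighted_cycle n "2 * half_turn n" "fool_pos n S T" "bin_label (half_turn n - 1)"
    using weighted_cycle_fool[OF n] .
  \<comment> \<open>Positions advance by about 2 per node, with 2 extra where the second half begins
    and at most 1 from a bit. All weights are thus at most 5, which \<open>n \<ge> 5\<close> turns
    into a bound by \<open>n\<close>.\<close>
  have step: "gap (fool_pos n S T x) (fool_pos n S T (Suc x)) \<le> 5" for x
  proof -
    have "2 * x \<le> fool_pos n S T x" "fool_pos n S T (Suc x) \<le> 2 * x + 5"
      using fool_pos_bounds[of x n S T] fool_pos_bounds[of "Suc x" n S T]
      by (cases "x < n div 2"; cases "Suc x < n div 2"; simp)+
    then show ?thesis using fool_pos_less[of x "Suc x" n S T] unfolding gap_def by simp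
  qed
  have wrap: "2 * half_turn n - gap (fool_pos n S T 0) (fool_pos n S T (n - 1)) \<le> 5"
  proof -
    have "fool_pos n S T 0 \<le> 1" "2 * n \<le> fool_pos n S T (n - 1)" "2 * half_turn n \<le> 2 * n + 4"
    proof -
      have "\<not> n - 1 < n div 2" using n by linarith
      then have "2 * (n - 1) + 2 \<le> fool_pos n S T (n - 1)" using fool_pos_bounds(2) by blast
      then show "2 * n \<le> fool_pos n S T (n - 1)" using n by linarith
      show "fool_pos n S T 0 \<le> 1" using fool_pos_bounds(1)[of 0 n S T] n by simp
      show "2 * half_turn n \<le> 2 * n + 4" unfolding half_turn_def by presburger
    qed
    then show ?thesis unfolding gap_def by linarith
  qed
  have gc: "gap x y = gap y x" for x y by (simp add: gap_def)
  show ?thesis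
    unfolding fool_graph_def
  proof (rule valid_cycle[OF assms(2)])
    fix x y assume a: "(x, y) \<in> parcs (cycle_graph n)"
    then consider "y = Suc x" "Suc x < n" | "x = Suc y" "Suc y < n"
      | "x = 0" "y = n - 1" | "y = 0" "x = n - 1" by (auto simp: cycle_graph_def)
    then have "cycle_weight (2 * half_turn n) (fool_pos n S T) (x, y) \<le> 5"
      using step wrap n gc by cases (auto simp: cycle_weight_def)
    then show "cycle_weight (2 * half_turn n) (fool_pos n S T) (x, y) \<le> n" using n by simp
  qed
qed

lemma fool_graph_simps [simp]:
  "nodes (fool_graph n S T) = {..<n}"
  "num_nodes (fool_graph n S T) = n"
  by (auto simp: fool_graph_def num_nodes_def)

lemma fool_graph_instance:
  assumes n: "n \<ge> 5" and "a \<ge> 1" "b \<ge> 1"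
  shows "instance_of a b (fool_graph n S T) Suc"
proof -
  have "real (Suc v) \<le> real n powr a" if "v < n" for v
  proof -
    have "real (Suc v) \<le> real n powr 1" using that by simp
    also have "\<dots> \<le> real n powr a" using assms by (intro powr_mono) auto
    finally show ?thesis .
  qed
  then show ?thesis
    unfolding instance_of_def valid_ids_def using fool_graph_valid[OF n assms(3)] by auto
qed

text \<open>All labels claim \<open>half_turn n - 1\<close>. For equal sets no pair is antipodal, so
  no distance exceeds this. For different sets, an element of just one of them yields an antipodal
  pair at distance \<open>half_turn n\<close>.\<close>

lemma fool_graph_DIAM:
  assumes n: "n \<ge> 5"
  shows "DIAM (fool_graph n S S)"
    and "\<lbrakk>S \<noteq> T; S \<subseteq> {..<n div 2}; T \<subseteq> {..<n div 2}\<rbrakk> \<Longrightarrow> \<not> DIAM (fool_graph n S T)"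
proof -
  have D: "DIAM (fool_graph n S T) \<longleftrightarrow>
    wgraph.diam {..<n} (id_arcs (fool_graph n S T) (\<lambda>x. x)) = half_turn n - 1" for S T
  proof -
    have "DIAM (fool_graph n S T) \<longleftrightarrow> (\<forall>v\<in>{..<n}. label_val (label_of (fool_graph n S T) v)
        = wgraph.diam {..<n} (id_arcs (fool_graph n S T) (\<lambda>x. x)))"
      using DIAM_iff[OF fool_graph_valid[OF n, of 1 S T], of "\<lambda>x. x"] by simp
    moreover have "label_val (label_of (fool_graph n S T) v) = half_turn n - 1" for v
      by (simp only: fool_graph_def cycle_lgraph_simps label_val_bin_label)
    moreover have "0 \<in> {..<n}" using n by simp
    ultimately show ?thesis by metis
  qed
  have W: "wgraph {..<n} (id_arcs (fool_graph n S T) (\<lambda>x. x))" for S T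
    using wgraph_id_arcs[OF fool_graph_valid[OF n, of 1 S T], of "\<lambda>x. x"] by simp
  have C: "weighted_cycle n (2 * half_turn n) (fool_pos n S T)" for S T
    using weighted_cycle_fool[OF n] .
  show "DIAM (fool_graph n S S)"
    unfolding D
  proof (rule antisym)
    interpret W: wgraph "{..<n}" "id_arcs (fool_graph n S S) (\<lambda>x. x)" using W .
    interpret C: weighted_cycle n "2 * half_turn n" "fool_pos n S S" "bin_label (half_turn n - 1)" using C .
    obtain i j where ij: "i < n" "j < n" "W.dst i j = W.diam" using W.diam_attained by auto
    have "gap (fool_pos n S S i) (fool_pos n S S j) \<noteq> half_turn n"
    proof (cases "i \<le> j")
      case True
      then show ?thesis
        using fool_pos_not_antipodal[OF True ij(2), of S S] C.p_le[OF True ij(2)] by (simp add: gap_def)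
    next
      case False
      then have ji: "j \<le> i" by simp
      then show ?thesis
        using fool_pos_not_antipodal[OF ji ij(1), of S S] C.p_le[OF ji ij(1)] by (simp add: gap_def)
    qed
    moreover have "W.diam \<le> min (gap (fool_pos n S S i) (fool_pos n S S j))
        (2 * half_turn n - gap (fool_pos n S S i) (fool_pos n S S j))"
      using C.dist_cycle_le[OF ij(1,2)] ij(3) unfolding fool_graph_def by simp
    ultimately show "W.diam \<le> half_turn n - 1" by linarith
    let ?m = "n div 2"
    have m: "?m < n" "0 < n" "0 < ?m" using n by auto
    \<comment> \<open>Nodes 0 and \<open>n div 2\<close> attain the value: their gap is one below or
      one above half a turn, according to whether 0 is in \<open>S\<close>.\<close>
    have "min (gap (fool_pos n S S ?m) (fool_pos n S S 0)) (2 * half_turn n - gap (fool_pos n S S ?m) (fool_pos n S S 0))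
       = half_turn n - 1"
      using m by (cases "0 \<in> S") (simp_all add: fool_pos_low fool_pos_high gap_def half_turn_def)
    then have "half_turn n - 1 \<le> W.dst 0 ?m"
      using C.dist_cycle_ge[OF m(1,2)] W.walk_hops[of 0 ?m] m unfolding fool_graph_def by auto
    then show "half_turn n - 1 \<le> W.diam" using W.dist_le_diam[of 0 ?m] m by auto
  qed
  assume ST: "S \<noteq> T" "S \<subseteq> {..<n div 2}" "T \<subseteq> {..<n div 2}"
  interpret W: wgraph "{..<n}" "id_arcs (fool_graph n S T) (\<lambda>x. x)" using W .
  interpret C: weighted_cycle n "2 * half_turn n" "fool_pos n S T" "bin_label (half_turn n - 1)" using C .
  obtain i where i: "i < n div 2" "(i \<in> S) \<noteq> (i \<in> T)" using ST by blast
  let ?j = "n div 2 + i"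
  have j: "?j < n" "i < n" using i by auto
  have "min (gap (fool_pos n S T ?j) (fool_pos n S T i)) (2 * half_turn n - gap (fool_pos n S T ?j) (fool_pos n S T i))
       = half_turn n"
    using i by (cases "i \<in> S") (simp_all add: fool_pos_low fool_pos_high gap_def half_turn_def)
  then have "half_turn n \<le> W.dst i ?j"
    using C.dist_cycle_ge[OF j] W.walk_hops[of i ?j] j unfolding fool_graph_def by auto
  then have "half_turn n \<le> W.diam" using W.dist_le_diam[of i ?j] j by auto
  then show "\<not> DIAM (fool_graph n S T)" unfolding D by (auto simp: half_turn_def)
qed

section \<open>Indistinguishable views and gluing of certificates\<close>

lemma hop_ball_cong: "graph_of L = graph_of L' \<Longrightarrow> hop_ball L r v = hop_ball L' r v"
  unfolding hop_ball_def by simp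

text \<open>Weights must agree also on arcs leaving the ball, since a view shows all weights
  incident to its nodes. This costs one extra hop of separation in the gluing argument.\<close>

lemma view_of_cong:
  assumes g: "graph_of L' = graph_of L" "label_of L' = label_of L"
    and c: "\<And>u. u \<in> hop_ball L r v \<Longrightarrow> cert' u = cert u"
    and w: "\<And>u y. u \<in> hop_ball L r v \<Longrightarrow> (u, y) \<in> parcs (graph_of L) \<Longrightarrow> weight_of L' (u, y) = weight_of L (u, y)"
  shows "view_of r L' ident cert' v = view_of r L ident cert v"
proof -
  have h: "hop_ball L' r v = hop_ball L r v" using g(1) by (rule hop_ball_cong)
  have ms: "image_mset (weight_of L') (mset_set (out_arcs (with_proj (graph_of L)) u))
      = image_mset (weight_of L) (mset_set (out_arcs (with_proj (graph_of L)) u))"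
    if "u \<in> hop_ball L r v" for u
  proof (rule image_mset_cong)
    fix e assume "e \<in># mset_set (out_arcs (with_proj (graph_of L)) u)"
    then have "e \<in> out_arcs (with_proj (graph_of L)) u"
      by (metis elem_mset_set mset_set.infinite empty_iff set_mset_empty)
    then show "weight_of L' e = weight_of L e"
      using w[OF that] by (cases e) (auto simp: out_arcs_def)
  qed
  show ?thesis
    unfolding view_of_def h g(1)
  proof (simp, intro conjI)
    show "(\<lambda>u. (ident u, label_of L' u, cert' u, image_mset (weight_of L') (mset_set (out_arcs (with_proj (graph_of L)) u)))) ` hop_ball L r v
      = (\<lambda>u. (ident u, label_of L u, cert u, image_mset (weight_of L) (mset_set (out_arcs (with_proj (graph_of L)) u)))) ` hop_ball L r v"
      using c ms g(2) by (intro image_cong) auto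
    show "(\<lambda>(x, y). (ident x, ident y, weight_of L' (x, y))) ` {(x, y). (x, y) \<in> parcs (graph_of L) \<and> x \<in> hop_ball L r v \<and> y \<in> hop_ball L r v}
      = (\<lambda>(x, y). (ident x, ident y, weight_of L (x, y))) ` {(x, y). (x, y) \<in> parcs (graph_of L) \<and> x \<in> hop_ball L r v \<and> y \<in> hop_ball L r v}"
      using w by (intro image_cong) auto
  qed
qed

lemma hop_ball_lipschitz:
  assumes wf: "pair_wf_digraph (graph_of L)"
    and f: "\<And>x y. (x, y) \<in> parcs (graph_of L) \<Longrightarrow> f x \<le> Suc (f y) \<and> f y \<le> Suc (f x)"
    and u: "u \<in> hop_ball L r v"
  shows "f u \<le> f v + r \<and> f v \<le> f u + r"
proof -
  obtain p where p: "is_awalk L v p u" "length p \<le> r" using u unfolding hop_ball_def by auto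
  have "walk (id_arcs L (\<lambda>x. x)) x k W z \<Longrightarrow> f z \<le> f x + k \<and> f x \<le> f z + k" for x k W z
  proof (induction rule: walk.induct)
    case (walk_step x y c k W z)
    then have "(x, y) \<in> parcs (graph_of L)" by (auto simp: id_arcs_def)
    then show ?case using walk_step f[of x y] by simp
  qed simp
  from this[OF awalk_imp_walk[OF wf p(1)]] p(2) show ?thesis by simp
qed

text \<open>If the certificates agreed on the two separating arcs, they could be glued into
  certificates for the cycle of \<open>S\<close> and \<open>T\<close>. Each node there would see the
  view of an accepted instance, of \<open>S\<close> with \<open>S\<close> or of \<open>T\<close>
  with \<open>T\<close>, although the diameter is wrong.\<close>

lemma fooling_certs_differ:
  assumes pls: "is_pls a b DIAM Z" and ab: "a \<ge> 1" "b \<ge> 1" and r: "radius Z \<le> t"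
    and n: "n \<ge> 5" and k: "k + 2 * t + 2 \<le> n div 2"
    and ST: "S \<subseteq> {..<k}" "T \<subseteq> {..<k}" "S \<noteq> T"
  shows "\<exists>v \<in> {k..<n div 2} \<union> {n div 2 + k..<n}.
    prover Z (fool_graph n S S) Suc v \<noteq> prover Z (fool_graph n T T) Suc v"
proof (rule ccontr)
  assume same: "\<not> ?thesis"
  define m where "m = n div 2"
  define c1 where "c1 = prover Z (fool_graph n S S) Suc"
  define c2 where "c2 = prover Z (fool_graph n T T) Suc"
  have eq: "c1 v = c2 v" if "v \<in> {k..<m} \<union> {m + k..<n}" for v
    using same that unfolding c1_def c2_def m_def by blast
  have nm: "2 * m \<le> n" "k + 2 * t + 2 \<le> m" using k unfolding m_def by auto
  \<comment> \<open>By the assumed agreement, \<open>c3\<close> equals \<open>c1\<close> everywhere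
    except on the nodes depending on \<open>T\<close>.\<close>
  define c3 where "c3 v = (if v < k then c1 v else c2 v)" for v
  have inst: "instance_of a b (fool_graph n S T) Suc" for S T
    using fool_graph_instance n ab by blast
  have acc1: "accepts_at Z (fool_graph n S S) Suc c1 v" if "v < n" for v
    using pls inst[of S S] fool_graph_DIAM(1)[OF n, of S] that unfolding is_pls_def c1_def by simp
  have acc2: "accepts_at Z (fool_graph n T T) Suc c2 v" if "v < n" for v
    using pls inst[of T T] fool_graph_DIAM(1)[OF n, of T] that unfolding is_pls_def c2_def by simp
  have "\<not> DIAM (fool_graph n S T)"
    using fool_graph_DIAM(2)[OF n ST(3)] ST(1,2) nm unfolding m_def by force
  then obtain v where v: "v < n" "\<not> accepts_at Z (fool_graph n S T) Suc c3 v"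
    using pls inst[of S T] unfolding is_pls_def by fastforce
  \<comment> \<open>\<open>f\<close> is the capped hop distance to the nodes depending on \<open>S\<close>: it is 0 on them, maximal on those
      depending on \<open>T\<close>, so no ball of radius \<open>t\<close> comes next to both.\<close>
  define f where "f i = min (2 * t + 3) (min (i + 1 - k) (n - i))" for i
  have wf: "pair_wf_digraph (cycle_graph n)"
    using pair_graph_cycle[of n] n unfolding pair_graph_def pair_digraph_def pair_fin_digraph_def by simp
  have lip: "f x \<le> Suc (f y) \<and> f y \<le> Suc (f x)" if "(x, y) \<in> parcs (cycle_graph n)" for x y
    using that unfolding f_def cycle_graph_def by (auto simp: min_def)
  have g: "graph_of (fool_graph n S T) = cycle_graph n" for S T
    by (simp add: fool_graph_def)
  have ball: "f u \<le> f v + t \<and> f v \<le> f u + t" if "u \<in> hop_ball (fool_graph n S T) (radius Z) v" for u S T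
    using hop_ball_lipschitz[of "fool_graph n S T" f u "radius Z" v] wf lip that r unfolding g by fastforce
  have fB: "f i = 2 * t + 3" if "m \<le> i" "i < m + k" for i
    using that nm unfolding f_def by auto
  have fA: "f i = 0" if "i < k" for i
    using that unfolding f_def by auto
  have pos1: "fool_pos n S T i = fool_pos n S S i" if "i < m \<or> m + k \<le> i" for i
  proof (cases "i < m")
    case False
    then have "i - m \<notin> S" "i - m \<notin> T" using that ST by auto
    then show ?thesis using False by (simp add: fool_pos_high m_def)
  qed (simp add: fool_pos_low m_def)
  have pos2: "fool_pos n S T i = fool_pos n T T i" if "k \<le> i" for i
  proof (cases "i < m")
    case True
    then have "i \<notin> S" "i \<notin> T" using that ST by auto
    then show ?thesis using True by (simp add: fool_pos_low m_def)
  qed (simp add: fool_pos_high m_def)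
  have ballN: "u < n" if "u \<in> hop_ball (fool_graph n S T) q v" for u q S T
    using hop_ball_nodes[of "fool_graph n S T"] wf that unfolding g by auto
  show False
  \<comment> \<open>If \<open>f v\<close> is at most \<open>t + 1\<close>, then \<open>f\<close> is
    at most \<open>2 * t + 1\<close> on the ball and \<open>2 * t + 2\<close> next to it, below its
    value on the nodes depending on \<open>T\<close>. Otherwise \<open>f\<close> is at least 2 on
    the ball and 1 next to it, so the nodes depending on \<open>S\<close> are avoided.\<close>
  proof (cases "f v \<le> t + 1")
    case True
    have "view_of (radius Z) (fool_graph n S T) Suc c3 v = view_of (radius Z) (fool_graph n S S) Suc c1 v"
    proof (rule view_of_cong)
      show "graph_of (fool_graph n S T) = graph_of (fool_graph n S S)"
        "label_of (fool_graph n S T) = label_of (fool_graph n S S)" by (simp_all add: fool_graph_def)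
      fix u assume u: "u \<in> hop_ball (fool_graph n S S) (radius Z) v"
      have fu: "f u \<le> 2 * t + 1" using ball[OF u] True by simp
      then have uB: "u < m \<or> m + k \<le> u" using fB[of u] by force
      show "c3 u = c1 u" unfolding c3_def using eq[of u] uB ballN[OF u] by auto
      fix y assume "(u, y) \<in> parcs (graph_of (fool_graph n S S))"
      then have "f y \<le> 2 * t + 2" using lip[of u y] fu unfolding g by simp
      then have "y < m \<or> m + k \<le> y" using fB[of y] by force
      then show "weight_of (fool_graph n S T) (u, y) = weight_of (fool_graph n S S) (u, y)"
        using pos1 uB by (simp add: fool_graph_def cycle_weight_def)
    qed
    then show False using v acc1 unfolding accepts_at_def by simp
  next
    case False
    have "view_of (radius Z) (fool_graph n S T) Suc c3 v = view_of (radius Z) (fool_graph n T T) Suc c2 v"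
    proof (rule view_of_cong)
      show "graph_of (fool_graph n S T) = graph_of (fool_graph n T T)"
        "label_of (fool_graph n S T) = label_of (fool_graph n T T)" by (simp_all add: fool_graph_def)
      fix u assume u: "u \<in> hop_ball (fool_graph n T T) (radius Z) v"
      have fu: "f u \<ge> 2" using ball[OF u] False by simp
      then have uA: "k \<le> u" using fA[of u] by force
      show "c3 u = c2 u" unfolding c3_def using uA by auto
      fix y assume "(u, y) \<in> parcs (graph_of (fool_graph n T T))"
      then have "f y \<ge> 1" using lip[of u y] fu unfolding g by simp
      then have "k \<le> y" using fA[of y] by force
      then show "weight_of (fool_graph n S T) (u, y) = weight_of (fool_graph n T T) (u, y)"
        using pos2 uA by (simp add: fool_graph_def cycle_weight_def)
    qed
    then show False using v acc2 unfolding accepts_at_def by simp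
  qed
qed

section \<open>Counting certificates, and the final bounds\<close>

lemma card_bool_lists_le: "card {xs :: bool list. length xs \<le> s} \<le> 2 ^ Suc s"
proof -
  have "card {xs :: bool list. length xs \<le> s} = (\<Sum>i\<le>s. 2 ^ i)"
    using card_lists_length_le[of "UNIV :: bool set" s] by simp
  also have "(\<Sum>i\<le>s. 2 ^ i) < (2::nat) ^ Suc s"
    by (induction s) auto
  finally show ?thesis by simp
qed

lemma finite_bool_lists_le: "finite {xs :: bool list. length xs \<le> s}"
  using finite_lists_length_le[of "UNIV :: bool set" s] by simp

text \<open>The certificates on the separating arcs determine the subset of \<open>{..<k}\<close>.
  So \<open>2 ^ k\<close> is at most the number of ways to put strings of length at most
  \<open>s\<close> on these arcs.\<close>

lemma fooling_count:
  assumes pls: "is_pls a b DIAM Z" and ab: "a \<ge> 1" "b \<ge> 1" and r: "radius Z \<le> t"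
    and n: "n \<ge> 5" and m: "2 * t + 2 \<le> n div 2" and s: "pls_size a b DIAM Z n \<le> enat s"
  shows "n div 2 - (2 * t + 2) \<le> Suc s * (4 * t + 5)"
proof -
  define k where "k = n div 2 - (2 * t + 2)"
  have k: "k + 2 * t + 2 \<le> n div 2" using m unfolding k_def by simp
  define A where "A = {k..<n div 2} \<union> {n div 2 + k..<n}"
  have "card A \<le> (n div 2 - k) + (n - (n div 2 + k))"
    unfolding A_def using card_Un_le[of "{k..<n div 2}" "{n div 2 + k..<n}"] by simp
  \<comment> \<open>Each arc has \<open>2 * t + 2\<close> nodes, and the second one has one more if
    \<open>n\<close> is odd.\<close>
  also have "\<dots> \<le> 4 * t + 5" using m unfolding k_def by simp
  finally have cA: "card A \<le> 4 * t + 5" .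
  have finA: "finite A" unfolding A_def by simp
  define F where "F S = restrict (prover Z (fool_graph n S S) Suc) A" for S
  have inj: "inj_on F (Pow {..<k})"
  proof (rule inj_onI, rule ccontr)
    fix S T assume ST: "S \<in> Pow {..<k}" "T \<in> Pow {..<k}" "F S = F T" "S \<noteq> T"
    then obtain v where "v \<in> A" "prover Z (fool_graph n S S) Suc v \<noteq> prover Z (fool_graph n T T) Suc v"
      using fooling_certs_differ[OF pls ab r n k, of S T] unfolding A_def by blast
    then show False using fun_cong[OF ST(3), of v] unfolding F_def by simp
  qed
  have len: "length (prover Z (fool_graph n S S) Suc v) \<le> s" if "v \<in> A" for S v
  proof -
    have "v < n" using that unfolding A_def by auto
    then have "enat (length (prover Z (fool_graph n S S) Suc v)) \<le> pls_size a b DIAM Z n"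
      unfolding pls_size_def using fool_graph_instance[OF n ab, of S S] fool_graph_DIAM(1)[OF n, of S]
      by (intro Sup_upper) fastforce
    then show ?thesis using s by (metis enat_ord_simps(1) order_trans)
  qed
  have "2 ^ k = card (Pow {..<k})" by (simp add: card_Pow)
  also have "\<dots> \<le> card (PiE A (\<lambda>_. {xs :: bool list. length xs \<le> s}))"
  proof (rule card_inj_on_le[OF inj])
    show "F ` Pow {..<k} \<subseteq> PiE A (\<lambda>_. {xs. length xs \<le> s})"
      unfolding F_def using len by auto
    show "finite (PiE A (\<lambda>_. {xs :: bool list. length xs \<le> s}))"
      using finA finite_bool_lists_le by (intro finite_PiE) auto
  qed
  also have "\<dots> = card {xs :: bool list. length xs \<le> s} ^ card A"
    using finA by (simp add: card_PiE)
  also have "\<dots> \<le> (2 ^ Suc s) ^ card A" by (intro power_mono card_bool_lists_le) auto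
  also have "\<dots> = 2 ^ (Suc s * card A)" by (simp only: power_mult)
  finally have "k \<le> Suc s * card A" by (simp only: power_increasing_iff one_less_numeral_iff semiring_norm)
  also have "\<dots> \<le> Suc s * (4 * t + 5)" using cA by (rule mult_le_mono2)
  finally show ?thesis unfolding k_def .
qed

lemma size_pls_lower:
  assumes ab: "a \<ge> 1" "b \<ge> 1" and n: "log 2 (real n) \<ge> 72" and t: "1 \<le> t" "real t \<le> real n / log 2 (real n)"
  shows "ereal (1 / 36 * (real n / (real t * log 2 (real n)))) \<le> ereal_of_enat (size_pls a b DIAM t n)"
proof -
  \<comment> \<open>Rounding up gives an integer bound on the sizes, which then passes to the
    infimum over all schemes.\<close>
  define q where "q = nat \<lceil>real n / (36 * real t)\<rceil>"
  have "72 * real t \<le> log 2 (real n) * real t" using n by (intro mult_right_mono) auto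
  also have "\<dots> \<le> real n" using t(2) n by (simp add: field_simps)
  finally have tn: "72 * real t \<le> real n" .
  then have tn': "72 * t \<le> n" by (metis of_nat_le_iff of_nat_mult of_nat_numeral)
  have n5: "n \<ge> 5" and m: "2 * t + 2 \<le> n div 2" using tn' t(1) by auto
  have "enat q \<le> pls_size a b DIAM Z n" if Z: "is_pls a b DIAM Z" "radius Z \<le> t" for Z
  proof (cases "pls_size a b DIAM Z n")
    case (enat s)
    have "n div 2 - (2 * t + 2) \<le> Suc s * (4 * t + 5)"
      using fooling_count[OF Z(1) ab Z(2) n5 m, of s] enat by simp
    also have "\<dots> \<le> Suc s * (9 * t)" using t(1) by (intro mult_le_mono2) simp
    also have "\<dots> = 9 * (Suc s * t)" by (rule mult.left_commute)
    finally have "n div 2 \<le> 9 * (Suc s * t) + (2 * t + 2)" by linarith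
    then have "2 * (n div 2) + 1 \<le> 2 * (9 * (Suc s * t) + (2 * t + 2)) + 1"
      by (intro add_le_mono1 mult_le_mono2)
    moreover have "n \<le> 2 * (n div 2) + 1" by presburger
    ultimately have "n \<le> 2 * (9 * (Suc s * t) + (2 * t + 2)) + 1" by (rule order_trans[rotated])
    then have "n \<le> 18 * (s * t) + 27 * t" using t(1) by (simp add: algebra_simps)
    then have "real n \<le> 18 * (real s * real t) + 27 * real t"
      by (metis (mono_tags, opaque_lifting) of_nat_add of_nat_le_iff of_nat_mult of_nat_numeral)
    \<comment> \<open>As \<open>72 * t \<le> n\<close>, the term \<open>27 * t\<close> is less than
      half of \<open>n\<close>, so \<open>18 * s * t\<close> is at least the other half.\<close>
    then have "real n \<le> 36 * (real s * real t)" using tn by linarith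
    then have "real n / (36 * real t) \<le> real s" using t(1) by (simp add: field_simps)
    then show ?thesis using enat unfolding q_def by (simp add: nat_le_iff ceiling_le_iff)
  qed simp
  then have "enat q \<le> size_pls a b DIAM t n"
    unfolding size_pls_def by (intro INF_greatest) auto
  then have "ereal_of_enat (enat q) \<le> ereal_of_enat (size_pls a b DIAM t n)"
    by (simp only: ereal_of_enat_le_iff)
  moreover have "1 / 36 * (real n / (real t * log 2 (real n))) \<le> real q"
  proof -
    have "1 / 36 * (real n / (real t * log 2 (real n))) = (real n / (36 * real t)) / log 2 (real n)" by simp
    also have "\<dots> \<le> (real n / (36 * real t)) / 1" using n by (intro divide_left_mono) auto
    also have "\<dots> \<le> real q" unfolding q_def by simp
    finally show ?thesis .
  qed
  ultimately show ?thesis by (metis ereal_less_eq(3) ereal_of_enat_simps(1) order_trans)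
qed

theorem theorem15:
  fixes a b :: real
  assumes "a \<ge> 1" and "b \<ge> 1"
  shows "(\<exists>c>0. \<exists>C>0. \<forall>\<^sub>F n::nat in sequentially. \<forall>t::nat.
            c * log 2 (real n) \<le> real t \<and> real t \<le> real n / log 2 (real n) \<longrightarrow>
            ereal_of_enat (size_pls a b DIAM t n)
              \<le> ereal (C * (real n / real t * (log 2 (real n))\<^sup>2)))
       \<and> (\<exists>C>0. \<forall>\<^sub>F n::nat in sequentially. \<forall>t::nat.
            1 \<le> t \<and> real t \<le> real n / log 2 (real n) \<longrightarrow>
            ereal (C * (real n / (real t * log 2 (real n))))
              \<le> ereal_of_enat (size_pls a b DIAM t n))"
proof (intro conjI)
  let ?C = "4 * (4 * (a + b + 3) + 3)"
  have "\<forall>\<^sub>F n::nat in sequentially. \<forall>t::nat.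
      1 * log 2 (real n) \<le> real t \<and> real t \<le> real n / log 2 (real n) \<longrightarrow>
      ereal_of_enat (size_pls a b DIAM t n) \<le> ereal (?C * (real n / real t * (log 2 (real n))\<^sup>2))"
    using eventually_ge_at_top[of "2::nat"]
  proof eventually_elim
    case (elim n)
    show ?case
    proof (intro allI impI)
      fix t :: nat
      assume t: "1 * log 2 (real n) \<le> real t \<and> real t \<le> real n / log 2 (real n)"
      \<comment> \<open>With \<open>c = 1\<close> the lower limit on \<open>t\<close> ensures that
        the radius is at least 1, the hop to the neighbours.\<close>
      have "1 \<le> log 2 (real n)" using elim by simp
      then have "t \<ge> 1" using t by linarith
      then show "ereal_of_enat (size_pls a b DIAM t n)
          \<le> ereal (?C * (real n / real t * (log 2 (real n))\<^sup>2))"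
        using size_pls_upper[OF assms elim] t by blast
    qed
  qed
  moreover have "?C > 0" using assms by simp
  ultimately show "\<exists>c>0. \<exists>C>0. \<forall>\<^sub>F n::nat in sequentially. \<forall>t::nat.
      c * log 2 (real n) \<le> real t \<and> real t \<le> real n / log 2 (real n) \<longrightarrow>
      ereal_of_enat (size_pls a b DIAM t n) \<le> ereal (C * (real n / real t * (log 2 (real n))\<^sup>2))"
    using zero_less_one by blast
next
  \<comment> \<open>The threshold \<open>2 ^ 72\<close> makes \<open>log 2 n\<close> at least 72, so
    the upper limit on \<open>t\<close> implies \<open>72 * t \<le> n\<close>.\<close>
  have "\<forall>\<^sub>F n::nat in sequentially. \<forall>t::nat.
      1 \<le> t \<and> real t \<le> real n / log 2 (real n) \<longrightarrow>
      ereal (1 / 36 * (real n / (real t * log 2 (real n)))) \<le> ereal_of_enat (size_pls a b DIAM t n)"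
    using eventually_ge_at_top[of "2 ^ 72 :: nat"]
  proof eventually_elim
    case (elim n)
    then have "(2::real) ^ 72 \<le> real n" by (metis of_nat_le_iff of_nat_numeral of_nat_power)
    moreover have "0 < real n" using elim by (cases n) auto
    ultimately have "72 \<le> log 2 (real n)" by (subst le_log_iff) (simp_all only: powr_numeral)
    then show ?case using size_pls_lower[OF assms] by blast
  qed
  then show "\<exists>C>0. \<forall>\<^sub>F n::nat in sequentially. \<forall>t::nat.
      1 \<le> t \<and> real t \<le> real n / log 2 (real n) \<longrightarrow>
      ereal (C * (real n / (real t * log 2 (real n)))) \<le> ereal_of_enat (size_pls a b DIAM t n)"
    by (intro exI[of _ "1 / 36"]) simp
qed

end
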